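(* Let $S$ be a restriction semigroup and let $R$ be a restriction monoid containing $S$ as a restriction (biunary) subsemigroup, such that for each $r\in R$: (i) there exists $e\in P_S$ with $e\le r^+$, and (ii) $er\in S$ for every $e\in P_S$ with $e\le r^+$; and dually there exists $f\in P_S$ with $f\le r^*$, and $rf\in S$ for every $f\in P_S$ with $f\le r^*$. Let $T$ be a plain monoid and $\alpha:T\to R$ a monoidal homomorphism (of plain monoids). Let $$S_{T,R}=\{(a,t)\in S\times T: a\le t\alpha\text{ in }R\},$$ and write $S_T$ for $S_{T,R}$ in the case $R=S^1$. Then, regarding $T$ as a restriction monoid, $S_{T,R}$ is an almost $T$-proper restriction subsemigroup of $S\times T$ with $S_{T,R}/\sigma\cong T$, and the first projection $S_{T,R}\to S$ is a $P$-separating homomorphism onto a full subsemigroup of $S$. Further: 1. if $S\subseteq (T\alpha)\!\downarrow$ (i.e. every $s\in S$ satisfies $s\le t\alpha$ in $R$ for some $t\in T$), then $S_{T,R}$ is a subdirect product of $S$ and $T$ and is therefore a cover of $S$ over $T$; in particular, if $R=S^1$ and $T\alpha$ $P$-generates $R$, then $S_T$ is a cover of $S$; 2. if $S$ is a monoid (so that $R=S^1=S$ in the definition of $S_T$) and $\alpha$ is monoidal, then $S_T$ is $T$-proper.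
   Context: A restriction semigroup is an algebra $(S,\cdot,{}^+,{}^* )$ with $(S,\cdot)$ a semigroup, satisfying $x^+x=x$, $(x^+y)^+=x^+y^+$, $x^+y^+=y^+x^+$, $xy^+=(xy)^+x$, the dual identities $xx^*=x$, $(yx^* )^*=y^*x^*$, $y^*x^*=x^*y^*$, $y^*x=x(yx)^*$, and $(x^+)^*=x^+$, $(x^* )^+=x^*$. Its projections form the semilattice $P_S=\{x^+:x\in S\}=\{x^*:x\in S\}$. A restriction monoid is a restriction semigroup with identity $1$ (so $1^+=1^*=1$). $S^1$ is $S$ if $S$ has an identity, and otherwise $S$ with an identity $1$ adjoined, $1^+=1^*=1$. A plain monoid is a monoid with no unary operations; it is regarded as a restriction monoid by setting $a^+=a^*=1$ for all $a$. The natural partial order is $a\le b$ iff $a=eb$ for some projection $e$; order ideals are nonempty downward-closed subsets. A subsemigroup closed under the unary operations is full if it contains all projections. A homomorphism is $P$-separating if it is injective on projections. Relations on $S$: $a\mathrel{\mathbb R}b$ iff $a^+=b^+$; $a\mathrel{\mathbb L}b$ iff $a^*=b^*$; $\sigma=\{(a,b): ea=eb\text{ for some }e\in P_S\}$ is the least congruence identifying all projections. $S$ is proper if $\mathbb R\cap\sigma$ and $\mathbb L\cap\sigma$ are both the identity relation. A cover of a restriction semigroup $U$ over a monoid $T$ is a proper restriction semigroup $V$ with $V/\sigma\cong T$ having $U$ as the image of a $P$-separating homomorphism (a cover of $U$ is the same without mention of $T$). A plain submonoid $T'$ of a restriction monoid $R$ $P$-generates $R$ if $R=P_RT'$. A restriction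 monoid $M$ with a plain submonoid $T'$ is $T'$-proper if $M=P_MT'$ and $\sigma$ separates $T'$; for an abstract monoid $T$, $M$ is $T$-proper if it is $T'$-proper for some submonoid $T'\cong T$. A permissible subset of $S$ is an order ideal $A$ with $a^+b=b^+a$ and $ab^*=ba^*$ for all $a,b\in A$; the set $C(S)$ of permissible subsets is a restriction monoid under multiplication of subsets, with $A^+=\{a^+:a\in A\}$, $A^*=\{a^*:a\in A\}$ and identity $P_S$. A restriction semigroup $S$ is almost $T$-proper if $C(S)$ is $T$-proper. *)

theory Defs
  imports "HOL-Algebra.Group" "HOL-Algebra.Coset"
begin

(* Signature (carrier, product, one, +, * ).  The field one is meaningful only where the
   structure is assumed to be a monoid; for a general restriction semigroup it is ignored. *)
record 'a restriction = "'a monoid" +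
  rplus :: "'a \<Rightarrow> 'a"
  rstar :: "'a \<Rightarrow> 'a"

locale restriction_semigroup =
  fixes S :: "('a, 'b) restriction_scheme" (structure)
  assumes nonempty: "carrier S \<noteq> {}"
    and m_closed: "\<lbrakk>x \<in> carrier S; y \<in> carrier S\<rbrakk> \<Longrightarrow> x \<otimes> y \<in> carrier S"
    and plus_closed: "x \<in> carrier S \<Longrightarrow> rplus S x \<in> carrier S"
    and star_closed: "x \<in> carrier S \<Longrightarrow> rstar S x \<in> carrier S"
    and m_assoc: "\<lbrakk>x \<in> carrier S; y \<in> carrier S; z \<in> carrier S\<rbrakk>
      \<Longrightarrow> (x \<otimes> y) \<otimes> z = x \<otimes> (y \<otimes> z)"
    and plus_left: "x \<in> carrier S \<Longrightarrow> rplus S x \<otimes> x = x"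
    and plus_mult: "\<lbrakk>x \<in> carrier S; y \<in> carrier S\<rbrakk>
      \<Longrightarrow> rplus S (rplus S x \<otimes> y) = rplus S x \<otimes> rplus S y"
    and plus_comm: "\<lbrakk>x \<in> carrier S; y \<in> carrier S\<rbrakk>
      \<Longrightarrow> rplus S x \<otimes> rplus S y = rplus S y \<otimes> rplus S x"
    and plus_ample: "\<lbrakk>x \<in> carrier S; y \<in> carrier S\<rbrakk>
      \<Longrightarrow> x \<otimes> rplus S y = rplus S (x \<otimes> y) \<otimes> x"
    and star_right: "x \<in> carrier S \<Longrightarrow> x \<otimes> rstar S x = x"
    and star_mult: "\<lbrakk>x \<in> carrier S; y \<in> carrier S\<rbrakk>
      \<Longrightarrow> rstar S (y \<otimes> rstar S x) = rstar S y \<otimes> rstar S x"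
    and star_comm: "\<lbrakk>x \<in> carrier S; y \<in> carrier S\<rbrakk>
      \<Longrightarrow> rstar S y \<otimes> rstar S x = rstar S x \<otimes> rstar S y"
    and star_ample: "\<lbrakk>x \<in> carrier S; y \<in> carrier S\<rbrakk>
      \<Longrightarrow> rstar S y \<otimes> x = x \<otimes> rstar S (y \<otimes> x)"
    and star_plus: "x \<in> carrier S \<Longrightarrow> rstar S (rplus S x) = rplus S x"
    and plus_star: "x \<in> carrier S \<Longrightarrow> rplus S (rstar S x) = rstar S x"

definition restriction_monoid :: "('a, 'b) restriction_scheme \<Rightarrow> bool" where
  "restriction_monoid M \<longleftrightarrow> restriction_semigroup M \<and> monoid M"

definition projections :: "('a, 'b) restriction_scheme \<Rightarrow> 'a set" where
  "projections S = rplus S ` carrier S"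

definition nat_le :: "('a, 'b) restriction_scheme \<Rightarrow> 'a \<Rightarrow> 'a \<Rightarrow> bool" where
  "nat_le S a b \<longleftrightarrow> (\<exists>e \<in> projections S. a = e \<otimes>\<^bsub>S\<^esub> b)"

definition order_ideal :: "('a, 'b) restriction_scheme \<Rightarrow> 'a set \<Rightarrow> bool" where
  "order_ideal S A \<longleftrightarrow> A \<subseteq> carrier S \<and> A \<noteq> {} \<and>
     (\<forall>b \<in> A. \<forall>a \<in> carrier S. nat_le S a b \<longrightarrow> a \<in> A)"

definition restriction_subsemigroup ::
    "('a, 'b) restriction_scheme \<Rightarrow> ('a, 'c) restriction_scheme \<Rightarrow> bool" where
  "restriction_subsemigroup V S \<longleftrightarrow> restriction_semigroup V \<and> carrier V \<subseteq> carrier S \<and>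
     (\<forall>x \<in> carrier V. \<forall>y \<in> carrier V. x \<otimes>\<^bsub>V\<^esub> y = x \<otimes>\<^bsub>S\<^esub> y) \<and>
     (\<forall>x \<in> carrier V. rplus V x = rplus S x \<and> rstar V x = rstar S x)"

definition full_subsemigroup ::
    "('a, 'b) restriction_scheme \<Rightarrow> ('a, 'c) restriction_scheme \<Rightarrow> bool" where
  "full_subsemigroup V S \<longleftrightarrow> restriction_subsemigroup V S \<and> projections S \<subseteq> carrier V"

definition restriction_hom ::
    "('a, 'c) restriction_scheme \<Rightarrow> ('b, 'd) restriction_scheme \<Rightarrow> ('a \<Rightarrow> 'b) set" where
  "restriction_hom S U = {h \<in> hom S U. \<forall>x \<in> carrier S.
     h (rplus S x) = rplus U (h x) \<and> h (rstar S x) = rstar U (h x)}"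

definition restriction_isomorphic ::
    "('a, 'c) restriction_scheme \<Rightarrow> ('b, 'd) restriction_scheme \<Rightarrow> bool" where
  "restriction_isomorphic S U \<longleftrightarrow>
     (\<exists>h \<in> restriction_hom S U. bij_betw h (carrier S) (carrier U))"

definition P_separating :: "('a, 'c) restriction_scheme \<Rightarrow> ('a \<Rightarrow> 'b) \<Rightarrow> bool" where
  "P_separating S h \<longleftrightarrow> inj_on h (projections S)"

definition R_rel :: "('a, 'b) restriction_scheme \<Rightarrow> ('a \<times> 'a) set" where
  "R_rel S = {(a, b). a \<in> carrier S \<and> b \<in> carrier S \<and> rplus S a = rplus S b}"

definition L_rel :: "('a, 'b) restriction_scheme \<Rightarrow> ('a \<times> 'a) set" where
  "L_rel S = {(a, b). a \<in> carrier S \<and> b \<in> carrier S \<and> rstar S a = rstar S b}"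

definition sigma :: "('a, 'b) restriction_scheme \<Rightarrow> ('a \<times> 'a) set" where
  "sigma S = {(a, b). a \<in> carrier S \<and> b \<in> carrier S \<and>
     (\<exists>e \<in> projections S. e \<otimes>\<^bsub>S\<^esub> a = e \<otimes>\<^bsub>S\<^esub> b)}"

definition proper :: "('a, 'b) restriction_scheme \<Rightarrow> bool" where
  "proper S \<longleftrightarrow> R_rel S \<inter> sigma S = Id_on (carrier S) \<and> L_rel S \<inter> sigma S = Id_on (carrier S)"

(* The quotient by sigma.  Each operation is the union of the classes obtained from all
   choices of representatives, hence a single class since sigma is a congruence; the
   identity of the quotient is the class of the projections. *)
definition sigma_quotient :: "('a, 'b) restriction_scheme \<Rightarrow> 'a set restriction" where
  "sigma_quotient S =
     \<lparr> carrier = carrier S // sigma S,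
       mult = (\<lambda>X Y. \<Union>x \<in> X. \<Union>y \<in> Y. sigma S `` {x \<otimes>\<^bsub>S\<^esub> y}),
       one = (\<Union>e \<in> projections S. sigma S `` {e}),
       rplus = (\<lambda>X. \<Union>x \<in> X. sigma S `` {rplus S x}),
       rstar = (\<lambda>X. \<Union>x \<in> X. sigma S `` {rstar S x}) \<rparr>"

(* A plain monoid regarded as a restriction monoid. *)
definition trivial_restriction :: "('t, 'b) monoid_scheme \<Rightarrow> 't restriction" where
  "trivial_restriction T =
     \<lparr> carrier = carrier T, mult = mult T, one = \<one>\<^bsub>T\<^esub>,
       rplus = (\<lambda>_. \<one>\<^bsub>T\<^esub>), rstar = (\<lambda>_. \<one>\<^bsub>T\<^esub>) \<rparr>"

definition restriction_prod ::
    "('a, 'c) restriction_scheme \<Rightarrow> ('b, 'd) restriction_scheme \<Rightarrow> ('a \<times> 'b) restriction" where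
  "restriction_prod S U =
     \<lparr> carrier = carrier S \<times> carrier U,
       mult = (\<lambda>(a, t) (b, u). (a \<otimes>\<^bsub>S\<^esub> b, t \<otimes>\<^bsub>U\<^esub> u)),
       one = (\<one>\<^bsub>S\<^esub>, \<one>\<^bsub>U\<^esub>),
       rplus = (\<lambda>(a, t). (rplus S a, rplus U t)),
       rstar = (\<lambda>(a, t). (rstar S a, rstar U t)) \<rparr>"

definition subdirect_product ::
    "('a \<times> 'b, 'e) restriction_scheme \<Rightarrow> ('a, 'c) restriction_scheme
      \<Rightarrow> ('b, 'd) restriction_scheme \<Rightarrow> bool" where
  "subdirect_product V S U \<longleftrightarrow> restriction_subsemigroup V (restriction_prod S U) \<and>
     fst ` carrier V = carrier S \<and> snd ` carrier V = carrier U"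

definition cover ::
    "('v, 'c) restriction_scheme \<Rightarrow> ('u, 'd) restriction_scheme \<Rightarrow> bool" where
  "cover V U \<longleftrightarrow> restriction_semigroup V \<and> proper V \<and>
     (\<exists>h \<in> restriction_hom V U. P_separating V h \<and> h ` carrier V = carrier U)"

definition cover_over ::
    "('v, 'c) restriction_scheme \<Rightarrow> ('u, 'd) restriction_scheme
      \<Rightarrow> ('t, 'e) monoid_scheme \<Rightarrow> bool" where
  "cover_over V U T \<longleftrightarrow> cover V U \<and>
     restriction_isomorphic (sigma_quotient V) (trivial_restriction T)"

definition P_generates :: "'a set \<Rightarrow> ('a, 'b) restriction_scheme \<Rightarrow> bool" where
  "P_generates T' M \<longleftrightarrow> submonoid T' M \<and> carrier M = projections M <#>\<^bsub>M\<^esub> T'"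

definition submonoid_proper :: "('a, 'b) restriction_scheme \<Rightarrow> 'a set \<Rightarrow> bool" where
  "submonoid_proper M T' \<longleftrightarrow> restriction_monoid M \<and> submonoid T' M \<and>
     carrier M = projections M <#>\<^bsub>M\<^esub> T' \<and>
     (\<forall>x \<in> T'. \<forall>y \<in> T'. (x, y) \<in> sigma M \<longrightarrow> x = y)"

definition T_proper ::
    "('a, 'b) restriction_scheme \<Rightarrow> ('t, 'c) monoid_scheme \<Rightarrow> bool" where
  "T_proper M T \<longleftrightarrow> (\<exists>T'. submonoid_proper M T' \<and> M\<lparr>carrier := T'\<rparr> \<cong> T)"

definition permissible :: "('a, 'b) restriction_scheme \<Rightarrow> 'a set \<Rightarrow> bool" where
  "permissible S A \<longleftrightarrow> order_ideal S A \<and>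
     (\<forall>a \<in> A. \<forall>b \<in> A. rplus S a \<otimes>\<^bsub>S\<^esub> b = rplus S b \<otimes>\<^bsub>S\<^esub> a \<and>
                      a \<otimes>\<^bsub>S\<^esub> rstar S b = b \<otimes>\<^bsub>S\<^esub> rstar S a)"

definition C_monoid :: "('a, 'b) restriction_scheme \<Rightarrow> 'a set restriction" where
  "C_monoid S =
     \<lparr> carrier = {A. permissible S A}, mult = (\<lambda>A B. A <#>\<^bsub>S\<^esub> B), one = projections S,
       rplus = (\<lambda>A. rplus S ` A), rstar = (\<lambda>A. rstar S ` A) \<rparr>"

definition almost_T_proper ::
    "('a, 'b) restriction_scheme \<Rightarrow> ('t, 'c) monoid_scheme \<Rightarrow> bool" where
  "almost_T_proper S T \<longleftrightarrow> T_proper (C_monoid S) T"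

definition has_identity :: "('a, 'b) restriction_scheme \<Rightarrow> bool" where
  "has_identity S \<longleftrightarrow>
     (\<exists>u \<in> carrier S. \<forall>x \<in> carrier S. u \<otimes>\<^bsub>S\<^esub> x = x \<and> x \<otimes>\<^bsub>S\<^esub> u = x)"

(* R = S^1.  A relation rather than a function because S^1 is determined only up to the
   choice of the adjoined element.  That the adjoined element lies outside S, and that its
   images under + and * are itself, is forced by the other conditions. *)
definition is_S1 ::
    "('a, 'c) restriction_scheme \<Rightarrow> ('a, 'b) restriction_scheme \<Rightarrow> bool" where
  "is_S1 R S \<longleftrightarrow> restriction_monoid R \<and> restriction_subsemigroup S R \<and>
     carrier R = (if has_identity S then carrier S else insert \<one>\<^bsub>R\<^esub> (carrier S))"

definition S_TR ::
    "('a, 'b) restriction_scheme \<Rightarrow> ('t, 'c) monoid_scheme \<Rightarrow> ('a, 'd) restriction_scheme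
      \<Rightarrow> ('t \<Rightarrow> 'a) \<Rightarrow> ('a \<times> 't) restriction" where
  "S_TR S T R \<alpha> = (restriction_prod S (trivial_restriction T))
     \<lparr>carrier := {(a, t). a \<in> carrier S \<and> t \<in> carrier T \<and> nat_le R a (\<alpha> t)}\<rparr>"

definition locally_absorbs ::
    "('a, 'b) restriction_scheme \<Rightarrow> ('a, 'c) restriction_scheme \<Rightarrow> bool" where
  "locally_absorbs S R \<longleftrightarrow> (\<forall>r \<in> carrier R.
     (\<exists>e \<in> projections S. nat_le R e (rplus R r)) \<and>
     (\<forall>e \<in> projections S. nat_le R e (rplus R r) \<longrightarrow> e \<otimes>\<^bsub>R\<^esub> r \<in> carrier S) \<and>
     (\<exists>f \<in> projections S. nat_le R f (rstar R r)) \<and>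
     (\<forall>f \<in> projections S. nat_le R f (rstar R r) \<longrightarrow> r \<otimes>\<^bsub>R\<^esub> f \<in> carrier S))"

(* S^1 always satisfies the hypotheses imposed on R. *)
lemma is_S1_locally_absorbs:
  assumes "is_S1 R S"
  shows "locally_absorbs S R"
proof -
  interpret R: restriction_semigroup R
    using assms by (simp add: is_S1_def restriction_monoid_def)
  interpret M: monoid R
    using assms by (simp add: is_S1_def restriction_monoid_def)
  have sub: "restriction_subsemigroup S R" using assms by (simp add: is_S1_def)
  interpret S: restriction_semigroup S
    using sub by (simp add: restriction_subsemigroup_def)
  have SR: "carrier S \<subseteq> carrier R"
    and mul: "\<And>x y. \<lbrakk>x \<in> carrier S; y \<in> carrier S\<rbrakk> \<Longrightarrow> x \<otimes>\<^bsub>S\<^esub> y = x \<otimes>\<^bsub>R\<^esub> y"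
    and pl: "\<And>x. x \<in> carrier S \<Longrightarrow> rplus S x = rplus R x"
    and st: "\<And>x. x \<in> carrier S \<Longrightarrow> rstar S x = rstar R x"
    using sub by (auto simp: restriction_subsemigroup_def)
  have PS: "projections S \<subseteq> carrier S"
    by (auto simp: projections_def S.plus_closed)
  have one1: "rplus R \<one>\<^bsub>R\<^esub> = \<one>\<^bsub>R\<^esub>" and one2: "rstar R \<one>\<^bsub>R\<^esub> = \<one>\<^bsub>R\<^esub>"
    using R.plus_left[of "\<one>\<^bsub>R\<^esub>"] R.star_right[of "\<one>\<^bsub>R\<^esub>"]
    by (simp_all add: R.plus_closed R.star_closed)
  have oneP: "\<one>\<^bsub>R\<^esub> \<in> projections R"
    unfolding projections_def using one1 by (metis M.one_closed imageI)
  have ref: "nat_le R x x" if "x \<in> carrier R" for x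
    unfolding nat_le_def using that oneP by (metis M.l_one)
  obtain s where s: "s \<in> carrier S" using S.nonempty by auto
  have starP: "rstar S x \<in> projections S" if "x \<in> carrier S" for x
    unfolding projections_def using S.plus_star[OF that] S.star_closed[OF that]
    by (metis imageI)
  have below_one: "\<exists>e \<in> projections S. nat_le R e \<one>\<^bsub>R\<^esub>"
  proof
    show "rplus S s \<in> projections S" using s by (simp add: projections_def)
    have "rplus R s \<in> projections R" using s SR by (auto simp: projections_def)
    moreover have "rplus R s \<otimes>\<^bsub>R\<^esub> \<one>\<^bsub>R\<^esub> = rplus R s" using s SR R.plus_closed by auto
    ultimately show "nat_le R (rplus S s) \<one>\<^bsub>R\<^esub>"
      unfolding nat_le_def using pl[OF s] by metis
  qed
  have "r \<in> carrier S \<or> r = \<one>\<^bsub>R\<^esub>" if "r \<in> carrier R" for r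
    using assms that by (auto simp: is_S1_def split: if_splits)
  moreover have "(\<exists>e \<in> projections S. nat_le R e (rplus R r)) \<and>
     (\<forall>e \<in> projections S. nat_le R e (rplus R r) \<longrightarrow> e \<otimes>\<^bsub>R\<^esub> r \<in> carrier S) \<and>
     (\<exists>f \<in> projections S. nat_le R f (rstar R r)) \<and>
     (\<forall>f \<in> projections S. nat_le R f (rstar R r) \<longrightarrow> r \<otimes>\<^bsub>R\<^esub> f \<in> carrier S)"
    if r: "r \<in> carrier S" for r
  proof (intro conjI ballI impI)
    have "nat_le R (rplus S r) (rplus R r)"
      using r ref[of "rplus R r"] pl[OF r] SR R.plus_closed by auto
    then show "\<exists>e \<in> projections S. nat_le R e (rplus R r)"
      using r unfolding projections_def by blast
    have "nat_le R (rstar S r) (rstar R r)"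
      using r ref[of "rstar R r"] st[OF r] SR R.star_closed by auto
    then show "\<exists>f \<in> projections S. nat_le R f (rstar R r)"
      using starP[OF r] by blast
  next
    fix e assume "e \<in> projections S"
    then have e: "e \<in> carrier S" using PS by auto
    show "e \<otimes>\<^bsub>R\<^esub> r \<in> carrier S" using S.m_closed[OF e r] mul[OF e r] by simp
    show "r \<otimes>\<^bsub>R\<^esub> e \<in> carrier S" using S.m_closed[OF r e] mul[OF r e] by simp
  qed
  moreover have "(\<exists>e \<in> projections S. nat_le R e (rplus R \<one>\<^bsub>R\<^esub>)) \<and>
     (\<forall>e \<in> projections S. nat_le R e (rplus R \<one>\<^bsub>R\<^esub>) \<longrightarrow> e \<otimes>\<^bsub>R\<^esub> \<one>\<^bsub>R\<^esub> \<in> carrier S) \<and>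
     (\<exists>f \<in> projections S. nat_le R f (rstar R \<one>\<^bsub>R\<^esub>)) \<and>
     (\<forall>f \<in> projections S. nat_le R f (rstar R \<one>\<^bsub>R\<^esub>) \<longrightarrow> \<one>\<^bsub>R\<^esub> \<otimes>\<^bsub>R\<^esub> f \<in> carrier S)"
    using below_one one1 one2 PS SR by (auto simp: subset_iff)
  ultimately show ?thesis unfolding locally_absorbs_def by blast
qed

end

(* An element (a, t) of S_{T,R} satisfies a = a\<^sup>+ (t \<alpha>) = (t \<alpha>) a\<^sup>*, so it is determined by t
   together with either a\<^sup>+ or a\<^sup>*.  Hence \<sigma> is equality of second coordinates, which makes
   S_{T,R} proper with quotient T.  The fibres A_t of the second projection are permissible subsets
   with A_t A_u = A_{tu} and A_1 the set of projections, so they form a copy of T in C(S_{T,R}).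
   Compatibility forces all elements of a permissible subset A to have the same second coordinate t,
   and then A = A\<^sup>+ A_t. *)

theory Submission
  imports Defs
begin

section \<open>Restriction semigroups\<close>

text \<open>The laws of C(S) come in mirror pairs, so only the halves about x^+ are proved; the
  others are read off in the opposite semigroup \<open>dual S\<close>. This is possible because the
  natural order, and with it permissibility, is left-right symmetric. Not every law of C(S) can be
  checked element by element: in A B^+ = (A B)^+ A the two occurrences of A on the right may pick
  different elements, and only compatibility lets one be exchanged for the other. The conditions on
  R are what make the fibres behave. A projection e of S below (t \<alpha>)^+, together with e (t
  \<alpha>) in S, makes A_t nonempty. Membership in S, applied at two well-chosen projections, gives
  the hard inclusion of A_{tu} in A_t A_u; the reverse inclusion is closure of S_{T,R} under
  products.\<close>

definition dual :: "('a, 'b) restriction_scheme \<Rightarrow> 'a restriction" where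
  "dual S = \<lparr> carrier = carrier S, mult = (\<lambda>x y. y \<otimes>\<^bsub>S\<^esub> x), one = \<one>\<^bsub>S\<^esub>,
     rplus = rstar S, rstar = rplus S \<rparr>"

lemma dual_simps [simp]:
  "carrier (dual S) = carrier S" "x \<otimes>\<^bsub>dual S\<^esub> y = y \<otimes>\<^bsub>S\<^esub> x" "\<one>\<^bsub>dual S\<^esub> = \<one>\<^bsub>S\<^esub>"
  "rplus (dual S) = rstar S" "rstar (dual S) = rplus S"
  by (simp_all add: dual_def)

lemma set_mult_dual [simp]: "A <#>\<^bsub>dual S\<^esub> B = B <#>\<^bsub>S\<^esub> A"
  by (auto simp: set_mult_def)

context restriction_semigroup
begin

text \<open>Reversing products and exchanging the unary operations permutes the axioms;
  associativity becomes itself read from right to left.\<close>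

lemma dual: "restriction_semigroup (dual S)"
  by (unfold_locales; unfold dual_simps)
    (rule nonempty m_closed plus_closed star_closed m_assoc[symmetric] plus_left plus_mult plus_comm
      plus_ample star_right star_mult star_comm star_ample star_plus plus_star; assumption)+

text \<open>Idempotence of \<open>rplus\<close> is not an axiom. For e = x^+ the law
  \<open>star_plus\<close> gives e^* = e, and \<open>plus_star\<close> at e then gives e^+ =
  e.\<close>

lemma projD:
  assumes "e \<in> projections S"
  shows "e \<in> carrier S" "rplus S e = e" "rstar S e = e"
  using assms plus_star star_plus plus_closed unfolding projections_def
  by (auto, metis)

lemma proj_plus: "x \<in> carrier S \<Longrightarrow> rplus S x \<in> projections S"
  by (simp add: projections_def)

lemma proj_star: "x \<in> carrier S \<Longrightarrow> rstar S x \<in> projections S"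
  by (metis plus_star proj_plus star_closed)

text \<open>Each x^+ is its own star and each x^* its own plus, so both unary operations have the
  same image.\<close>

lemma projections_dual [simp]: "projections (dual S) = projections S"
  using proj_plus proj_star projD unfolding projections_def[of "dual S"]
  by (auto, metis imageI)

lemma proj_mult: "\<lbrakk>e \<in> projections S; f \<in> projections S\<rbrakk> \<Longrightarrow> e \<otimes> f \<in> projections S"
  by (metis plus_mult projD(1,2) m_closed proj_plus)

lemma proj_comm: "\<lbrakk>e \<in> projections S; f \<in> projections S\<rbrakk> \<Longrightarrow> e \<otimes> f = f \<otimes> e"
  by (metis plus_comm projD(1,2))

lemma proj_idem: "e \<in> projections S \<Longrightarrow> e \<otimes> e = e"
  by (metis plus_left projD(1,2))

lemma plus_proj_mult:
  "\<lbrakk>e \<in> projections S; x \<in> carrier S\<rbrakk> \<Longrightarrow> rplus S (e \<otimes> x) = e \<otimes> rplus S x"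
  by (metis plus_mult projD(1,2))

lemma mult_proj_plus:
  "\<lbrakk>x \<in> carrier S; e \<in> projections S\<rbrakk> \<Longrightarrow> x \<otimes> e = rplus S (x \<otimes> e) \<otimes> x"
  by (metis plus_ample projD(1,2))

text \<open>Since x y = x^+ (x y), \<open>plus_mult\<close> pulls x^+ out of (x y)^+; in order terms
  (x y)^+ lies below x^+.\<close>

lemma plus_mult_left:
  "\<lbrakk>x \<in> carrier S; y \<in> carrier S\<rbrakk> \<Longrightarrow> rplus S (x \<otimes> y) = rplus S (x \<otimes> y) \<otimes> rplus S x"
  by (metis plus_mult plus_left m_assoc plus_closed m_closed plus_comm)

text \<open>From a = e b follows a^+ = e b^+, hence a^+ b = e b^+ b = a: the arbitrary witness e can
  always be replaced by a^+.\<close>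

lemma nat_le_plus:
  assumes "b \<in> carrier S" "nat_le S a b"
  shows "a \<in> carrier S" "a = rplus S a \<otimes> b" "rplus S a \<otimes> rplus S b = rplus S a"
proof -
  obtain e where e: "e \<in> projections S" "a = e \<otimes> b"
    using assms(2) by (auto simp: nat_le_def)
  note eC = projD(1)[OF e(1)]
  show "a \<in> carrier S" using e eC assms(1) m_closed by simp
  have p: "rplus S a = e \<otimes> rplus S b" using e assms(1) plus_proj_mult by simp
  then show "a = rplus S a \<otimes> b"
    using e(2) eC assms(1) m_assoc plus_closed plus_left by simp
  show "rplus S a \<otimes> rplus S b = rplus S a"
    using p eC assms(1) m_assoc plus_closed proj_idem proj_plus by simp
qed

lemma nat_leI: "\<lbrakk>e \<in> projections S; a = e \<otimes> b\<rbrakk> \<Longrightarrow> nat_le S a b"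
  by (auto simp: nat_le_def)

text \<open>A projection satisfies e = e^*, so the ample law for \<open>rstar\<close> moves it
  across b and e b becomes b a^* with a = e b.\<close>

lemma nat_le_star:
  assumes "b \<in> carrier S" "nat_le S a b"
  shows "a = b \<otimes> rstar S a"
  using assms star_ample[of b] projD unfolding nat_le_def by metis

text \<open>The ample law gives b e = (b e)^+ b. With \<open>nat_le_star\<close> this shows that
  left and right multiples by projections define the same order.\<close>

lemma nat_leI_right:
  assumes "b \<in> carrier S" "e \<in> projections S" "a = b \<otimes> e"
  shows "nat_le S a b"
  by (metis assms m_closed mult_proj_plus nat_leI projD(1) proj_plus)

lemma nat_le_dual: "b \<in> carrier S \<Longrightarrow> nat_le (dual S) a b \<longleftrightarrow> nat_le S a b"
  by (metis dual dual_simps(1,2,4) nat_le_plus(1) nat_le_star nat_leI_right nat_le_def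
      projections_dual proj_star)

end

section \<open>Subalgebras, plain monoids, direct products and quotients by sigma\<close>

lemma (in restriction_semigroup) restriction_subalgebra:
  assumes "A \<subseteq> carrier S" "A \<noteq> {}"
    and "\<And>x y. \<lbrakk>x \<in> A; y \<in> A\<rbrakk> \<Longrightarrow> x \<otimes> y \<in> A"
    and "\<And>x. x \<in> A \<Longrightarrow> rplus S x \<in> A" "\<And>x. x \<in> A \<Longrightarrow> rstar S x \<in> A"
  shows "restriction_subsemigroup (S\<lparr>carrier := A\<rparr>) S"
proof -
  have "restriction_semigroup (S\<lparr>carrier := A\<rparr>)"
  proof
    fix x y assume "x \<in> carrier (S\<lparr>carrier := A\<rparr>)" "y \<in> carrier (S\<lparr>carrier := A\<rparr>)"
    then have xy: "x \<in> carrier S" "y \<in> carrier S" using assms(1) by auto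
    show "x \<otimes>\<^bsub>S\<lparr>carrier := A\<rparr>\<^esub> rplus (S\<lparr>carrier := A\<rparr>) y =
        rplus (S\<lparr>carrier := A\<rparr>) (x \<otimes>\<^bsub>S\<lparr>carrier := A\<rparr>\<^esub> y) \<otimes>\<^bsub>S\<lparr>carrier := A\<rparr>\<^esub> x"
      using plus_ample[OF xy] by simp
    show "rplus (S\<lparr>carrier := A\<rparr>) x \<otimes>\<^bsub>S\<lparr>carrier := A\<rparr>\<^esub> rplus (S\<lparr>carrier := A\<rparr>) y =
       rplus (S\<lparr>carrier := A\<rparr>) y \<otimes>\<^bsub>S\<lparr>carrier := A\<rparr>\<^esub> rplus (S\<lparr>carrier := A\<rparr>) x"
      using plus_comm[OF xy] by simp
    show "rstar (S\<lparr>carrier := A\<rparr>) y \<otimes>\<^bsub>S\<lparr>carrier := A\<rparr>\<^esub> rstar (S\<lparr>carrier := A\<rparr>) x =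
       rstar (S\<lparr>carrier := A\<rparr>) x \<otimes>\<^bsub>S\<lparr>carrier := A\<rparr>\<^esub> rstar (S\<lparr>carrier := A\<rparr>) y"
      using star_comm[OF xy] by simp
    show "rstar (S\<lparr>carrier := A\<rparr>) y \<otimes>\<^bsub>S\<lparr>carrier := A\<rparr>\<^esub> x =
       x \<otimes>\<^bsub>S\<lparr>carrier := A\<rparr>\<^esub> rstar (S\<lparr>carrier := A\<rparr>) (y \<otimes>\<^bsub>S\<lparr>carrier := A\<rparr>\<^esub> x)"
      using star_ample[OF xy] by simp
  qed (use assms in \<open>auto simp: subset_iff m_assoc plus_left plus_mult star_right star_mult
      star_plus plus_star\<close>)
  then show ?thesis using assms(1) by (simp add: restriction_subsemigroup_def)
qed

lemma trivial_restriction_simps [simp]: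
  "carrier (trivial_restriction T) = carrier T"
  "x \<otimes>\<^bsub>trivial_restriction T\<^esub> y = x \<otimes>\<^bsub>T\<^esub> y"
  "rplus (trivial_restriction T) x = \<one>\<^bsub>T\<^esub>" "rstar (trivial_restriction T) x = \<one>\<^bsub>T\<^esub>"
  by (simp_all add: trivial_restriction_def)

lemma (in monoid) trivial_restriction: "restriction_semigroup (trivial_restriction G)"
proof
  show "carrier (trivial_restriction G) \<noteq> {}" using one_closed by auto
qed (simp_all add: m_assoc)

lemma restriction_prod:
  assumes "restriction_semigroup S" "restriction_semigroup U"
  shows "restriction_semigroup (restriction_prod S U)"
proof -
  interpret S: restriction_semigroup S by fact
  interpret U: restriction_semigroup U by fact
  show ?thesis
  proof
    fix x y assume xy: "x \<in> carrier (restriction_prod S U)" "y \<in> carrier (restriction_prod S U)"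
    show "x \<otimes>\<^bsub>restriction_prod S U\<^esub> rplus (restriction_prod S U) y =
      rplus (restriction_prod S U) (x \<otimes>\<^bsub>restriction_prod S U\<^esub> y) \<otimes>\<^bsub>restriction_prod S U\<^esub> x"
      using xy S.plus_ample[of "fst x" "fst y"] U.plus_ample[of "snd x" "snd y"]
      by (simp add: restriction_prod_def case_prod_beta mem_Times_iff)
    show "rplus (restriction_prod S U) x \<otimes>\<^bsub>restriction_prod S U\<^esub> rplus (restriction_prod S U) y =
      rplus (restriction_prod S U) y \<otimes>\<^bsub>restriction_prod S U\<^esub> rplus (restriction_prod S U) x"
      using xy S.plus_comm[of "fst x" "fst y"] U.plus_comm[of "snd x" "snd y"]
      by (simp add: restriction_prod_def case_prod_beta mem_Times_iff)
    show "rstar (restriction_prod S U) y \<otimes>\<^bsub>restriction_prod S U\<^esub> rstar (restriction_prod S U) x =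
      rstar (restriction_prod S U) x \<otimes>\<^bsub>restriction_prod S U\<^esub> rstar (restriction_prod S U) y"
      using xy S.star_comm[of "fst x" "fst y"] U.star_comm[of "snd x" "snd y"]
      by (simp add: restriction_prod_def case_prod_beta mem_Times_iff)
    show "rstar (restriction_prod S U) y \<otimes>\<^bsub>restriction_prod S U\<^esub> x =
      x \<otimes>\<^bsub>restriction_prod S U\<^esub> rstar (restriction_prod S U) (y \<otimes>\<^bsub>restriction_prod S U\<^esub> x)"
      using xy S.star_ample[of "fst x" "fst y"] U.star_ample[of "snd x" "snd y"]
      by (simp add: restriction_prod_def case_prod_beta mem_Times_iff)
  qed (auto simp: restriction_prod_def S.nonempty U.nonempty S.m_closed U.m_closed S.plus_closed
      U.plus_closed S.star_closed U.star_closed S.m_assoc U.m_assoc S.plus_left U.plus_left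
      S.plus_mult U.plus_mult S.star_right U.star_right S.star_mult U.star_mult S.star_plus
      U.star_plus S.plus_star U.plus_star)
qed

text \<open>The isomorphism sends a class to the common value of \<open>f\<close> on it.\<close>

lemma (in restriction_semigroup) sigma_quotient_isomorphic:
  fixes T :: "('t, 'c) monoid_scheme"
  assumes "monoid T"
    and f: "f \<in> restriction_hom S (trivial_restriction T)"
    and surj: "f ` carrier S = carrier T"
    and ker: "sigma S = {(a, b). a \<in> carrier S \<and> b \<in> carrier S \<and> f a = f b}"
  shows "restriction_isomorphic (sigma_quotient S) (trivial_restriction T)"
proof -
  let ?cl = "\<lambda>a. {b \<in> carrier S. f b = f a}"
  let ?h = "\<lambda>X. the_elem (f ` X)"
  have fm: "f (a \<otimes> b) = f a \<otimes>\<^bsub>T\<^esub> f b" if "a \<in> carrier S" "b \<in> carrier S" for a b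
    using f that by (auto simp: restriction_hom_def hom_def)
  have fp: "f (rplus S a) = \<one>\<^bsub>T\<^esub>" "f (rstar S a) = \<one>\<^bsub>T\<^esub>" if "a \<in> carrier S" for a
    using f that by (auto simp: restriction_hom_def)
  have im: "sigma S `` {a} = ?cl a" if "a \<in> carrier S" for a
    using ker that by auto
  have hcl: "?h (?cl a) = f a" if "a \<in> carrier S" for a
  proof -
    have "f ` ?cl a = {f a}" using that by auto
    then show ?thesis by simp
  qed
  have car: "carrier (sigma_quotient S) = ?cl ` carrier S"
    using im by (auto simp: sigma_quotient_def quotient_def)
  have mult: "?cl a \<otimes>\<^bsub>sigma_quotient S\<^esub> ?cl b = ?cl (a \<otimes> b)"
    if "a \<in> carrier S" "b \<in> carrier S" for a b
  proof -
    \<comment> \<open>Multiplicativity of \<open>f\<close> makes the class independent of the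
      representatives, so the union defining the quotient product runs over one constant set; it
      collapses because \<open>a\<close> and \<open>b\<close> keep both index sets nonempty.\<close>
    have "sigma S `` {x \<otimes> y} = ?cl (a \<otimes> b)" if "x \<in> ?cl a" "y \<in> ?cl b" for x y
      using that im \<open>a \<in> carrier S\<close> \<open>b \<in> carrier S\<close> by (simp add: m_closed fm)
    then have "(\<Union>x \<in> ?cl a. \<Union>y \<in> ?cl b. sigma S `` {x \<otimes> y}) = (\<Union>x \<in> ?cl a. \<Union>y \<in> ?cl b. ?cl (a \<otimes> b))"
      by (intro SUP_cong refl) blast
    also have "\<dots> = ?cl (a \<otimes> b)" using that by auto
    finally show ?thesis by (simp add: sigma_quotient_def)
  qed
  have plus: "rplus (sigma_quotient S) (?cl a) = ?cl (rplus S a)" if "a \<in> carrier S" for a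
  proof -
    have "sigma S `` {rplus S x} = ?cl (rplus S a)" if "x \<in> ?cl a" for x
      using that im \<open>a \<in> carrier S\<close> by (simp add: plus_closed fp)
    then have "(\<Union>x \<in> ?cl a. sigma S `` {rplus S x}) = (\<Union>x \<in> ?cl a. ?cl (rplus S a))"
      by (intro SUP_cong refl) blast
    also have "\<dots> = ?cl (rplus S a)" using that by auto
    finally show ?thesis by (simp add: sigma_quotient_def)
  qed
  have star: "rstar (sigma_quotient S) (?cl a) = ?cl (rstar S a)" if "a \<in> carrier S" for a
  proof -
    have "sigma S `` {rstar S x} = ?cl (rstar S a)" if "x \<in> ?cl a" for x
      using that im \<open>a \<in> carrier S\<close> by (simp add: star_closed fp)
    then have "(\<Union>x \<in> ?cl a. sigma S `` {rstar S x}) = (\<Union>x \<in> ?cl a. ?cl (rstar S a))"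
      by (intro SUP_cong refl) blast
    also have "\<dots> = ?cl (rstar S a)" using that by auto
    finally show ?thesis by (simp add: sigma_quotient_def)
  qed
  have "?h \<in> restriction_hom (sigma_quotient S) (trivial_restriction T)"
  proof -
    have "?h (X \<otimes>\<^bsub>sigma_quotient S\<^esub> Y) = ?h X \<otimes>\<^bsub>T\<^esub> ?h Y"
      if XY: "X \<in> ?cl ` carrier S" "Y \<in> ?cl ` carrier S" for X Y
    proof -
      obtain a b where "a \<in> carrier S" "b \<in> carrier S" "X = ?cl a" "Y = ?cl b"
        using XY by blast
      then show ?thesis using hcl[OF m_closed] by (simp only: mult hcl fm[symmetric])
    qed
    moreover have "?h X \<in> carrier T \<and> ?h (rplus (sigma_quotient S) X) = \<one>\<^bsub>T\<^esub>
        \<and> ?h (rstar (sigma_quotient S) X) = \<one>\<^bsub>T\<^esub>"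
      if X: "X \<in> ?cl ` carrier S" for X
    proof -
      obtain a where a: "a \<in> carrier S" "X = ?cl a" using X by blast
      then have "f a \<in> carrier T" using surj by auto
      moreover have "?h (rplus (sigma_quotient S) X) = f (rplus S a)"
        unfolding a(2) plus[OF a(1)] by (rule hcl[OF plus_closed[OF a(1)]])
      moreover have "?h (rstar (sigma_quotient S) X) = f (rstar S a)"
        unfolding a(2) star[OF a(1)] by (rule hcl[OF star_closed[OF a(1)]])
      moreover have "?h X = f a" unfolding a(2) by (rule hcl[OF a(1)])
      ultimately show ?thesis using fp[OF a(1)] by simp
    qed
    ultimately show ?thesis
      unfolding restriction_hom_def hom_def car by simp
  qed
  moreover have "bij_betw ?h (carrier (sigma_quotient S)) (carrier (trivial_restriction T))"
    unfolding bij_betw_def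
  proof
    show "inj_on ?h (carrier (sigma_quotient S))"
    proof (rule inj_onI)
      fix X Y
      assume "X \<in> carrier (sigma_quotient S)" "Y \<in> carrier (sigma_quotient S)" and e: "?h X = ?h Y"
      then obtain a b where ab: "a \<in> carrier S" "b \<in> carrier S" "X = ?cl a" "Y = ?cl b"
        unfolding car by blast
      then have "f a = f b" using e hcl by simp
      then show "X = Y" using ab by simp
    qed
    have "?h ` ?cl ` carrier S = f ` carrier S"
      unfolding image_image using hcl by (rule image_cong[OF refl])
    then show "?h ` carrier (sigma_quotient S) = carrier (trivial_restriction T)"
      using surj car by simp
  qed
  ultimately show ?thesis unfolding restriction_isomorphic_def by blast
qed

text \<open>The required submonoid is the image of \<beta>. Injectivity of \<beta> comes out of
  \<open>sep\<close>, because equal values are sigma-related by reflexivity.\<close>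

lemma T_properI:
  assumes "restriction_monoid M" "monoid T"
    and hom: "\<beta> \<in> hom T M" and one: "\<beta> \<one>\<^bsub>T\<^esub> = \<one>\<^bsub>M\<^esub>"
    and gen: "\<And>x. x \<in> carrier M \<Longrightarrow> \<exists>e \<in> projections M. \<exists>t \<in> carrier T. x = e \<otimes>\<^bsub>M\<^esub> \<beta> t"
    and sep: "\<And>t u. \<lbrakk>t \<in> carrier T; u \<in> carrier T; (\<beta> t, \<beta> u) \<in> sigma M\<rbrakk> \<Longrightarrow> t = u"
  shows "T_proper M T"
proof -
  interpret M: restriction_semigroup M using assms(1) by (simp add: restriction_monoid_def)
  interpret MM: monoid M using assms(1) by (simp add: restriction_monoid_def)
  interpret T: monoid T by fact
  have bc: "\<beta> t \<in> carrier M" if "t \<in> carrier T" for t using hom that by (auto simp: hom_def)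
  have bm: "\<beta> (t \<otimes>\<^bsub>T\<^esub> u) = \<beta> t \<otimes>\<^bsub>M\<^esub> \<beta> u" if "t \<in> carrier T" "u \<in> carrier T" for t u
    using hom that by (auto simp: hom_def)
  have inj: "inj_on \<beta> (carrier T)"
  proof (rule inj_onI)
    fix t u assume "t \<in> carrier T" "u \<in> carrier T" "\<beta> t = \<beta> u"
    moreover have "(\<beta> t, \<beta> t) \<in> sigma M"
      using bc[OF \<open>t \<in> carrier T\<close>] M.proj_plus by (auto simp: sigma_def)
    ultimately show "t = u" using sep[of t u] by simp
  qed
  have "submonoid (\<beta> ` carrier T) M"
  proof
    show "\<beta> ` carrier T \<subseteq> carrier M" using bc by auto
    show "\<one>\<^bsub>M\<^esub> \<in> \<beta> ` carrier T" using one imageI[OF T.one_closed, of \<beta>] by simp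
    show "x \<otimes>\<^bsub>M\<^esub> y \<in> \<beta> ` carrier T" if "x \<in> \<beta> ` carrier T" "y \<in> \<beta> ` carrier T" for x y
      using that by (auto simp: bm[symmetric])
  qed
  moreover have "carrier M = projections M <#>\<^bsub>M\<^esub> (\<beta> ` carrier T)"
    using gen bc M.projD(1) M.m_closed by (fastforce simp: set_mult_def)
  ultimately have "submonoid_proper M (\<beta> ` carrier T)"
    using assms(1) sep by (auto simp: submonoid_proper_def)
  \<comment> \<open>\<open>T_proper\<close> asks for an isomorphism from the submonoid to
    \<open>T\<close>, hence the inverse of \<beta>.\<close>
  moreover have "inv_into (carrier T) \<beta> \<in> iso (M\<lparr>carrier := \<beta> ` carrier T\<rparr>) T"
  proof -
    have "bij_betw (inv_into (carrier T) \<beta>) (\<beta> ` carrier T) (carrier T)"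
      using inj by (simp add: bij_betw_inv_into inj_on_imp_bij_betw)
    moreover have "inv_into (carrier T) \<beta> (\<beta> t \<otimes>\<^bsub>M\<^esub> \<beta> u) = t \<otimes>\<^bsub>T\<^esub> u"
      if "t \<in> carrier T" "u \<in> carrier T" for t u
      using that inj by (simp add: bm[symmetric])
    ultimately show ?thesis using inj by (auto simp: iso_def hom_def)
  qed
  ultimately show ?thesis unfolding T_proper_def is_iso_def by blast
qed

section \<open>The monoid of permissible subsets\<close>

lemma C_monoid_simps [simp]:
  "A \<in> carrier (C_monoid S) \<longleftrightarrow> permissible S A"
  "A \<otimes>\<^bsub>C_monoid S\<^esub> B = A <#>\<^bsub>S\<^esub> B" "\<one>\<^bsub>C_monoid S\<^esub> = projections S"
  "rplus (C_monoid S) A = rplus S ` A" "rstar (C_monoid S) A = rstar S ` A"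
  by (simp_all add: C_monoid_def)

context restriction_semigroup
begin

text \<open>As a \<le> b means a = e b for a projection e, downward closure amounts to closure under
  left multiplication by projections, the form used throughout.\<close>

lemma permissibleD:
  assumes "permissible S A"
  shows "A \<subseteq> carrier S" "A \<noteq> {}"
    and "\<And>a e. \<lbrakk>a \<in> A; e \<in> projections S\<rbrakk> \<Longrightarrow> e \<otimes> a \<in> A"
    and "\<And>a b. \<lbrakk>a \<in> A; b \<in> A\<rbrakk> \<Longrightarrow> rplus S a \<otimes> b = rplus S b \<otimes> a"
proof -
  show A: "A \<subseteq> carrier S" "A \<noteq> {}" using assms by (auto simp: permissible_def order_ideal_def)
  have dn: "x \<in> A" if "a \<in> A" "nat_le S x a" for x a
    using assms that A nat_le_plus(1) by (auto simp: permissible_def order_ideal_def)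
  show "e \<otimes> a \<in> A" if "a \<in> A" "e \<in> projections S" for a e
    using dn[OF that(1) nat_leI[OF that(2) refl]] .
  show "rplus S a \<otimes> b = rplus S b \<otimes> a" if "a \<in> A" "b \<in> A" for a b
    using assms that by (auto simp: permissible_def)
qed

lemma permissibleI:
  assumes "A \<subseteq> carrier S" "A \<noteq> {}"
    and "\<And>a e. \<lbrakk>a \<in> A; e \<in> projections S\<rbrakk> \<Longrightarrow> e \<otimes> a \<in> A"
    and "\<And>a b. \<lbrakk>a \<in> A; b \<in> A\<rbrakk> \<Longrightarrow> rplus S a \<otimes> b = rplus S b \<otimes> a"
    and "\<And>a b. \<lbrakk>a \<in> A; b \<in> A\<rbrakk> \<Longrightarrow> a \<otimes> rstar S b = b \<otimes> rstar S a"
  shows "permissible S A"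
  using assms by (auto simp: permissible_def order_ideal_def nat_le_def)

lemma permissible_dual [simp]: "permissible (dual S) A \<longleftrightarrow> permissible S A"
proof -
  have "order_ideal (dual S) A \<longleftrightarrow> order_ideal S A"
    using nat_le_dual unfolding order_ideal_def by (auto simp: subset_iff)
  then show ?thesis by (auto simp: permissible_def)
qed

lemma set_mult_compatible:
  assumes A: "permissible S A" and B: "permissible S B"
    and ac: "a \<in> A" "c \<in> A" and bd: "b \<in> B" "d \<in> B"
  shows "rplus S (a \<otimes> b) \<otimes> (c \<otimes> d) = rplus S (c \<otimes> d) \<otimes> (a \<otimes> b)"
proof -
  \<comment> \<open>The right-hand side c^+ a d^+ b is a common form for both products:
    compatibility gives c^+ a = a^+ c and d^+ b = b^+ d, so it is unchanged when (a, b) and (c, d)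
    are exchanged.\<close>
  have *: "rplus S (a \<otimes> b) \<otimes> (c \<otimes> d) = rplus S c \<otimes> a \<otimes> (rplus S d \<otimes> b)"
    if ac: "a \<in> A" "c \<in> A" and bd: "b \<in> B" "d \<in> B" for a b c d
  proof -
    have C: "a \<in> carrier S" "b \<in> carrier S" "c \<in> carrier S" "d \<in> carrier S"
      using permissibleD(1)[OF A] permissibleD(1)[OF B] that by auto
    note cl = C m_closed plus_closed
    have "rplus S (a \<otimes> b) \<otimes> (c \<otimes> d) = rplus S (a \<otimes> b) \<otimes> rplus S a \<otimes> (c \<otimes> d)"
      using plus_mult_left[OF C(1,2)] by simp
    also have "\<dots> = rplus S (a \<otimes> b) \<otimes> (rplus S a \<otimes> c) \<otimes> d"
      using cl by (simp add: m_assoc)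
    also have "\<dots> = rplus S (a \<otimes> b) \<otimes> (rplus S c \<otimes> a) \<otimes> d"
      using permissibleD(4)[OF A ac] by simp
    also have "\<dots> = rplus S (a \<otimes> b) \<otimes> rplus S c \<otimes> a \<otimes> d"
      using cl by (simp add: m_assoc)
    also have "\<dots> = rplus S c \<otimes> rplus S (a \<otimes> b) \<otimes> a \<otimes> d"
      using cl by (simp add: plus_comm)
    also have "\<dots> = rplus S c \<otimes> (rplus S (a \<otimes> b) \<otimes> a) \<otimes> d"
      using cl by (simp add: m_assoc)
    also have "\<dots> = rplus S c \<otimes> (a \<otimes> rplus S b) \<otimes> d"
      using cl plus_ample[of a b] by simp
    also have "\<dots> = rplus S c \<otimes> a \<otimes> (rplus S b \<otimes> d)"
      using cl by (simp add: m_assoc)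
    finally show ?thesis using permissibleD(4)[OF B bd] by simp
  qed
  show ?thesis
    using *[OF ac bd] *[OF ac(2,1) bd(2,1)] permissibleD(4)[OF A ac] permissibleD(4)[OF B bd] by simp
qed

lemma permissible_set_mult:
  assumes A: "permissible S A" and B: "permissible S B"
  shows "permissible S (A <#> B)"
proof (rule permissibleI)
  interpret D: restriction_semigroup "dual S" by (rule dual)
  note AC = permissibleD(1)[OF A] and BC = permissibleD(1)[OF B]
  show "A <#> B \<subseteq> carrier S" using AC BC m_closed by (auto simp: set_mult_def)
  show "A <#> B \<noteq> {}" using permissibleD(2)[OF A] permissibleD(2)[OF B]
    by (auto simp: set_mult_def)
  show "e \<otimes> x \<in> A <#> B" if xe: "x \<in> A <#> B" "e \<in> projections S" for x e
  proof -
    obtain a b where ab: "a \<in> A" "b \<in> B" "x = a \<otimes> b" using xe by (auto simp: set_mult_def)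
    then have "e \<otimes> x = (e \<otimes> a) \<otimes> b"
      using AC BC projD(1)[OF xe(2)] m_assoc[of e a b] by (simp add: subset_iff)
    then show ?thesis using ab permissibleD(3)[OF A ab(1) xe(2)] by (auto simp: set_mult_def)
  qed
  show "rplus S x \<otimes> y = rplus S y \<otimes> x" if "x \<in> A <#> B" "y \<in> A <#> B" for x y
    using that set_mult_compatible[OF A B] by (auto simp: set_mult_def)
  \<comment> \<open>Mirror image of the preceding case; the product is reversed in
    \<open>dual S\<close>, so \<open>A\<close> and \<open>B\<close> change places.\<close>
  show "x \<otimes> rstar S y = y \<otimes> rstar S x" if "x \<in> A <#> B" "y \<in> A <#> B" for x y
    using that D.set_mult_compatible[of B A] A B by (auto simp: set_mult_def)
qed

text \<open>A projection is fixed by both unary operations, so both compatibility conditions reduce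
  to commutativity of projections.\<close>

lemma permissible_proj_subset:
  assumes "E \<subseteq> projections S" "E \<noteq> {}"
    and "\<And>f e. \<lbrakk>f \<in> E; e \<in> projections S\<rbrakk> \<Longrightarrow> e \<otimes> f \<in> E"
  shows "permissible S E"
  using assms by (intro permissibleI) (auto simp: subset_iff projD proj_comm)

lemma permissible_plus:
  assumes A: "permissible S A"
  shows "permissible S (rplus S ` A)"
proof (rule permissible_proj_subset)
  show "rplus S ` A \<subseteq> projections S" using permissibleD(1)[OF A] proj_plus by auto
  show "rplus S ` A \<noteq> {}" using permissibleD(2)[OF A] by auto
  show "e \<otimes> f \<in> rplus S ` A" if "f \<in> rplus S ` A" "e \<in> projections S" for e f
    using that permissibleD(1,3)[OF A] plus_proj_mult by (auto simp: image_iff subset_iff) metis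
qed

lemma permissible_projections: "permissible S (projections S)"
  using nonempty proj_plus by (intro permissible_proj_subset) (auto simp: proj_mult)

lemma C_plus_left:
  assumes A: "permissible S A"
  shows "(rplus S ` A) <#> A = A"
proof -
  note AC = permissibleD(1)[OF A]
  have "a \<in> (rplus S ` A) <#> A" if "a \<in> A" for a
  proof -
    have "a = rplus S a \<otimes> a" using that AC plus_left by auto
    then show ?thesis using that by (auto simp: set_mult_def)
  qed
  moreover have "rplus S a \<otimes> b \<in> A" if "a \<in> A" "b \<in> A" for a b
    using permissibleD(3)[OF A that(2)] proj_plus AC that by auto
  ultimately show ?thesis by (auto simp: set_mult_def)
qed

lemma C_plus_ample:
  assumes A: "permissible S A" and B: "permissible S B"
  shows "A <#> (rplus S ` B) = (rplus S ` (A <#> B)) <#> A"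
proof -
  have C: "x \<in> carrier S" if "x \<in> A \<or> x \<in> B" for x
    using permissibleD(1)[OF A] permissibleD(1)[OF B] that by auto
  have "a \<otimes> rplus S b \<in> (rplus S ` (A <#> B)) <#> A" if "a \<in> A" "b \<in> B" for a b
    using plus_ample[of a b] that C by (auto simp: set_mult_def)
  \<comment> \<open>Here \<open>c\<close> need not be \<open>a\<close>. Inserting a^+ on the right
    of (a b)^+ creates a^+ c = c^+ a, which turns the expression into (c^+ a) b^+, and c^+ a is
    still in \<open>A\<close> by downward closure.\<close>
  moreover have "rplus S (a \<otimes> b) \<otimes> c \<in> A <#> (rplus S ` B)" if abc: "a \<in> A" "b \<in> B" "c \<in> A" for a b c
  proof -
    note cl = C[of a] C[of b] C[of c] m_closed plus_closed abc
    have "rplus S (a \<otimes> b) \<otimes> c = rplus S (a \<otimes> b) \<otimes> rplus S a \<otimes> c"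
      using plus_mult_left[of a b] cl by simp
    also have "\<dots> = rplus S (a \<otimes> b) \<otimes> (rplus S c \<otimes> a)"
      using cl permissibleD(4)[OF A abc(1,3)] by (simp add: m_assoc)
    also have "\<dots> = rplus S (a \<otimes> b) \<otimes> rplus S c \<otimes> a"
      using cl by (simp add: m_assoc)
    also have "\<dots> = rplus S c \<otimes> rplus S (a \<otimes> b) \<otimes> a"
      using cl by (simp add: plus_comm)
    also have "\<dots> = rplus S c \<otimes> (rplus S (a \<otimes> b) \<otimes> a)"
      using cl by (simp add: m_assoc)
    also have "\<dots> = rplus S c \<otimes> (a \<otimes> rplus S b)"
      using cl plus_ample[of a b] by simp
    also have "\<dots> = (rplus S c \<otimes> a) \<otimes> rplus S b"
      using cl by (simp add: m_assoc)
    finally have "rplus S (a \<otimes> b) \<otimes> c = (rplus S c \<otimes> a) \<otimes> rplus S b" .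
    moreover have "rplus S c \<otimes> a \<in> A"
      using permissibleD(3)[OF A abc(1) proj_plus] C abc by simp
    ultimately show ?thesis using abc(2) by (auto simp: set_mult_def)
  qed
  ultimately show ?thesis by (auto simp: set_mult_def)
qed

lemma C_plus_mult:
  assumes "permissible S A" "permissible S B"
  shows "rplus S ` ((rplus S ` A) <#> B) = (rplus S ` A) <#> (rplus S ` B)"
proof -
  have "rplus S (rplus S a \<otimes> b) = rplus S a \<otimes> rplus S b" if "a \<in> A" "b \<in> B" for a b
    using that permissibleD(1)[OF assms(1)] permissibleD(1)[OF assms(2)] plus_mult by blast
  then show ?thesis by (simp add: set_mult_def image_UN cong: SUP_cong_simp)
qed

lemma C_plus_comm:
  assumes "permissible S A" "permissible S B"
  shows "(rplus S ` A) <#> (rplus S ` B) = (rplus S ` B) <#> (rplus S ` A)"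
proof -
  have "rplus S a \<otimes> rplus S b = rplus S b \<otimes> rplus S a" if "a \<in> A" "b \<in> B" for a b
    using that permissibleD(1)[OF assms(1)] permissibleD(1)[OF assms(2)] plus_comm by blast
  then have "(rplus S ` A) <#> (rplus S ` B) = (\<Union>a\<in>A. \<Union>b\<in>B. {rplus S b \<otimes> rplus S a})"
    unfolding set_mult_def by (intro equalityI subsetI) fastforce+
  also have "\<dots> = (rplus S ` B) <#> (rplus S ` A)"
    unfolding set_mult_def by blast
  finally show ?thesis .
qed

lemma C_star_plus: "permissible S A \<Longrightarrow> rstar S ` rplus S ` A = rplus S ` A"
  using permissibleD(1)[of A] star_plus by (auto simp: image_image subset_iff)

lemma C_assoc:
  assumes "A \<subseteq> carrier S" "B \<subseteq> carrier S" "C \<subseteq> carrier S"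
  shows "A <#> B <#> C = A <#> (B <#> C)"
proof -
  have *: "(a \<otimes> b) \<otimes> c = a \<otimes> (b \<otimes> c)" if "a \<in> A" "b \<in> B" "c \<in> C" for a b c
    using that assms m_assoc by blast
  show ?thesis
  proof
    show "A <#> B <#> C \<subseteq> A <#> (B <#> C)"
      unfolding set_mult_def by (clarsimp simp: *; blast)
    show "A <#> (B <#> C) \<subseteq> A <#> B <#> C"
      unfolding set_mult_def by (clarsimp simp: *[symmetric]; blast)
  qed
qed

lemma C_l_one:
  assumes A: "permissible S A"
  shows "projections S <#> A = A"
proof
  show "projections S <#> A \<subseteq> A" using permissibleD(3)[OF A] by (auto simp: set_mult_def)
  have "A = (rplus S ` A) <#> A" using C_plus_left[OF A] by simp
  also have "\<dots> \<subseteq> projections S <#> A"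
    using permissibleD(1)[OF A] proj_plus by (auto simp: set_mult_def)
  finally show "A \<subseteq> projections S <#> A" .
qed

theorem C_monoid_restriction: "restriction_monoid (C_monoid S)"
proof -
  interpret D: restriction_semigroup "dual S" by (rule dual)
  \<comment> \<open>The star laws of C(S) are the plus laws for \<open>dual S\<close>, which has the
    same permissible sets and projections and the reversed set product.\<close>
  note d = D.permissible_plus D.C_plus_left D.C_plus_ample D.C_plus_mult D.C_plus_comm
    D.C_star_plus D.C_l_one
  note d' = d[unfolded permissible_dual set_mult_dual dual_simps projections_dual]
  have ne: "carrier (C_monoid S) \<noteq> {}" using C_monoid_simps(1) permissible_projections by blast
  have "restriction_semigroup (C_monoid S)"
    by (unfold_locales; (unfold C_monoid_simps)?)
      (rule ne | rule C_assoc permissible_set_mult permissible_plus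
        C_plus_left C_plus_mult C_plus_comm C_plus_ample C_star_plus d'; (rule permissibleD)?; assumption)+
  moreover have "monoid (C_monoid S)"
    by (unfold_locales; (unfold C_monoid_simps)?)
      (rule permissible_projections | rule C_assoc permissible_set_mult C_l_one d';
        (rule permissibleD)?; assumption)+
  ultimately show ?thesis by (simp add: restriction_monoid_def)
qed

end

section \<open>The cover\<close>

lemma restriction_prod_simps [simp]:
  "carrier (restriction_prod S U) = carrier S \<times> carrier U"
  "(a, t) \<otimes>\<^bsub>restriction_prod S U\<^esub> (b, u) = (a \<otimes>\<^bsub>S\<^esub> b, t \<otimes>\<^bsub>U\<^esub> u)"
  "rplus (restriction_prod S U) (a, t) = (rplus S a, rplus U t)"
  "rstar (restriction_prod S U) (a, t) = (rstar S a, rstar U t)"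
  by (simp_all add: restriction_prod_def)

locale restriction_cover =
  fixes S :: "('a, 'b) restriction_scheme"
    and R :: "('a, 'c) restriction_scheme"
    and T :: "('t, 'd) monoid_scheme"
    and \<alpha> :: "'t \<Rightarrow> 'a"
  assumes S: "restriction_semigroup S"
    and R: "restriction_monoid R"
    and sub: "restriction_subsemigroup S R"
    and abs: "locally_absorbs S R"
    and T: "monoid T"
    and \<alpha>: "\<alpha> \<in> hom T R" "\<alpha> \<one>\<^bsub>T\<^esub> = \<one>\<^bsub>R\<^esub>"
begin

sublocale S: restriction_semigroup S by (rule S)
sublocale R: restriction_semigroup R using R by (simp add: restriction_monoid_def)
sublocale RM: monoid R using R by (simp add: restriction_monoid_def)
sublocale T: monoid T by (rule T)

abbreviation V :: "('a \<times> 't) restriction" where "V \<equiv> S_TR S T R \<alpha>"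

lemma S_in_R: "a \<in> carrier S \<Longrightarrow> a \<in> carrier R"
  using sub by (auto simp: restriction_subsemigroup_def)

lemma S_ops:
  "\<lbrakk>a \<in> carrier S; b \<in> carrier S\<rbrakk> \<Longrightarrow> a \<otimes>\<^bsub>S\<^esub> b = a \<otimes>\<^bsub>R\<^esub> b"
  "a \<in> carrier S \<Longrightarrow> rplus S a = rplus R a"
  "a \<in> carrier S \<Longrightarrow> rstar S a = rstar R a"
  using sub by (auto simp: restriction_subsemigroup_def)

text \<open>The order in the definition of \<open>S_TR\<close> is that of \<open>R\<close>, so
  projections of \<open>S\<close> serve as its witnesses only once they are known to be projections
  of \<open>R\<close>.\<close>

lemma proj_S_R: "e \<in> projections S \<Longrightarrow> e \<in> projections R"
  by (metis R.proj_plus S.projD(1,2) S_in_R S_ops(2))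

lemma \<alpha>_closed: "t \<in> carrier T \<Longrightarrow> \<alpha> t \<in> carrier R"
  and \<alpha>_mult: "\<lbrakk>t \<in> carrier T; u \<in> carrier T\<rbrakk> \<Longrightarrow> \<alpha> (t \<otimes>\<^bsub>T\<^esub> u) = \<alpha> t \<otimes>\<^bsub>R\<^esub> \<alpha> u"
  using \<alpha>(1) by (auto simp: hom_def)

lemma V_simps [simp]:
  "(a, t) \<in> carrier V \<longleftrightarrow> a \<in> carrier S \<and> t \<in> carrier T \<and> nat_le R a (\<alpha> t)"
  "(a, t) \<otimes>\<^bsub>V\<^esub> (b, u) = (a \<otimes>\<^bsub>S\<^esub> b, t \<otimes>\<^bsub>T\<^esub> u)"
  "\<one>\<^bsub>V\<^esub> = (\<one>\<^bsub>S\<^esub>, \<one>\<^bsub>T\<^esub>)"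
  "rplus V (a, t) = (rplus S a, \<one>\<^bsub>T\<^esub>)" "rstar V (a, t) = (rstar S a, \<one>\<^bsub>T\<^esub>)"
  by (simp_all add: S_TR_def restriction_prod_def trivial_restriction_def)

lemma V_decomp:
  assumes "(a, t) \<in> carrier V"
  shows "a = rplus R a \<otimes>\<^bsub>R\<^esub> \<alpha> t" "a = \<alpha> t \<otimes>\<^bsub>R\<^esub> rstar R a"
  using assms R.nat_le_plus(2) R.nat_le_star \<alpha>_closed by auto

text \<open>As \<alpha> preserves the identity, e = e \<alpha>(1), so every projection of
  \<open>S\<close> lies below \<alpha>(1).\<close>

lemma V_proj:
  assumes "e \<in> projections S"
  shows "(e, \<one>\<^bsub>T\<^esub>) \<in> carrier V"
proof -
  have e: "e \<in> projections R" "e \<in> carrier S" using assms proj_S_R S.projD by auto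
  then have "e = e \<otimes>\<^bsub>R\<^esub> \<alpha> \<one>\<^bsub>T\<^esub>" using R.projD(1) \<alpha>(2) by simp
  then show ?thesis using e by (auto intro: R.nat_leI)
qed

text \<open>Writing a from the left as a^+ \<alpha>(t) and b from the right as \<alpha>(u) b^* puts
  the two values of \<alpha> side by side, where they merge into \<alpha>(tu). The ample law then
  carries b^* over to the left.\<close>

lemma V_mult:
  assumes at: "(a, t) \<in> carrier V" and bu: "(b, u) \<in> carrier V"
  shows "(a \<otimes>\<^bsub>S\<^esub> b, t \<otimes>\<^bsub>T\<^esub> u) \<in> carrier V"
proof -
  let ?r = "\<alpha> (t \<otimes>\<^bsub>T\<^esub> u)" and ?f = "rstar R b" and ?e = "rplus R a"
  have C: "a \<in> carrier S" "b \<in> carrier S" "t \<in> carrier T" "u \<in> carrier T" using at bu by auto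
  note cl = C S_in_R[OF C(1)] S_in_R[OF C(2)] \<alpha>_closed[OF C(3)] \<alpha>_closed[OF C(4)]
    R.m_closed R.plus_closed R.star_closed
  have r: "?r \<in> carrier R" using C \<alpha>_closed by simp
  have "a \<otimes>\<^bsub>R\<^esub> b = (?e \<otimes>\<^bsub>R\<^esub> \<alpha> t) \<otimes>\<^bsub>R\<^esub> (\<alpha> u \<otimes>\<^bsub>R\<^esub> ?f)"
    using V_decomp(1)[OF at] V_decomp(2)[OF bu] by simp
  also have "\<dots> = ?e \<otimes>\<^bsub>R\<^esub> (?r \<otimes>\<^bsub>R\<^esub> ?f)"
    using cl by (simp add: R.m_assoc \<alpha>_mult)
  also have "\<dots> = ?e \<otimes>\<^bsub>R\<^esub> (rplus R (?r \<otimes>\<^bsub>R\<^esub> ?f) \<otimes>\<^bsub>R\<^esub> ?r)"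
    using R.mult_proj_plus[OF r R.proj_star, of b] cl by simp
  also have "\<dots> = (?e \<otimes>\<^bsub>R\<^esub> rplus R (?r \<otimes>\<^bsub>R\<^esub> ?f)) \<otimes>\<^bsub>R\<^esub> ?r"
    using cl r by (simp add: R.m_assoc)
  finally have "nat_le R (a \<otimes>\<^bsub>R\<^esub> b) ?r"
    by (rule R.nat_leI[rotated]) (use cl r in \<open>simp add: R.proj_mult R.proj_plus\<close>)
  then show ?thesis using C S_ops(1) S.m_closed by simp
qed

text \<open>The source of elements with a prescribed second coordinate: restricting \<alpha>(t) to a
  projection of \<open>S\<close> below its plus brings it into \<open>S\<close> by local
  absorption.\<close>

lemma V_restrict:
  assumes "e \<in> projections S" "t \<in> carrier T" "nat_le R e (rplus R (\<alpha> t))"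
  shows "(e \<otimes>\<^bsub>R\<^esub> \<alpha> t, t) \<in> carrier V"
proof -
  have "e \<otimes>\<^bsub>R\<^esub> \<alpha> t \<in> carrier S"
    using abs \<alpha>_closed[OF assms(2)] assms(1,3) unfolding locally_absorbs_def by blast
  then show ?thesis using assms(1,2) proj_S_R R.nat_leI by auto
qed

lemma V_onto_T:
  assumes "t \<in> carrier T"
  shows "\<exists>a. (a, t) \<in> carrier V"
proof -
  obtain e where "e \<in> projections S" "nat_le R e (rplus R (\<alpha> t))"
    using abs \<alpha>_closed[OF assms] unfolding locally_absorbs_def by blast
  then show ?thesis using V_restrict assms by blast
qed

lemma V_subsemigroup: "restriction_subsemigroup V (restriction_prod S (trivial_restriction T))"
proof -
  interpret P: restriction_semigroup "restriction_prod S (trivial_restriction T)"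
    using S T.trivial_restriction by (rule restriction_prod)
  have "restriction_subsemigroup ((restriction_prod S (trivial_restriction T))\<lparr>carrier := carrier V\<rparr>)
      (restriction_prod S (trivial_restriction T))"
  proof (rule P.restriction_subalgebra)
    show "carrier V \<subseteq> carrier (restriction_prod S (trivial_restriction T))" by auto
    show "carrier V \<noteq> {}" using V_onto_T[OF T.one_closed] by blast
    fix x assume x: "x \<in> carrier V"
    then obtain a t where at: "x = (a, t)" "a \<in> carrier S" by (cases x) auto
    show "rplus (restriction_prod S (trivial_restriction T)) x \<in> carrier V"
      using at V_proj[OF S.proj_plus] by simp
    show "rstar (restriction_prod S (trivial_restriction T)) x \<in> carrier V"
      using at V_proj[OF S.proj_star] by simp
    fix y assume "y \<in> carrier V"
    then show "x \<otimes>\<^bsub>restriction_prod S (trivial_restriction T)\<^esub> y \<in> carrier V"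
      using x V_mult by (cases x; cases y) auto
  qed
  then show ?thesis by (simp add: S_TR_def)
qed

sublocale V: restriction_semigroup V
  using V_subsemigroup by (simp add: restriction_subsemigroup_def)

section \<open>Projections, compatibility, sigma and properness in S_{T,R}\<close>

lemma projections_V: "projections V = (\<lambda>e. (e, \<one>\<^bsub>T\<^esub>)) ` projections S"
proof
  show "projections V \<subseteq> (\<lambda>e. (e, \<one>\<^bsub>T\<^esub>)) ` projections S"
    using S.proj_plus by (auto simp: projections_def[of V])
  show "(\<lambda>e. (e, \<one>\<^bsub>T\<^esub>)) ` projections S \<subseteq> projections V"
  proof
    fix x assume "x \<in> (\<lambda>e. (e, \<one>\<^bsub>T\<^esub>)) ` projections S"
    then obtain e where e: "x = (e, \<one>\<^bsub>T\<^esub>)" "e \<in> projections S" by auto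
    then have "x = rplus V (e, \<one>\<^bsub>T\<^esub>)" using S.projD by simp
    then show "x \<in> projections V" using V.proj_plus[OF V_proj[OF e(2)]] by simp
  qed
qed

text \<open>Both a^+ b and b^+ a equal a^+ b^+ \<alpha>(t), and dually for stars.\<close>

lemma V_compatible:
  assumes "(a, t) \<in> carrier V" "(b, t) \<in> carrier V"
  shows "rplus S a \<otimes>\<^bsub>S\<^esub> b = rplus S b \<otimes>\<^bsub>S\<^esub> a" "a \<otimes>\<^bsub>S\<^esub> rstar S b = b \<otimes>\<^bsub>S\<^esub> rstar S a"
proof -
  have C: "a \<in> carrier S" "b \<in> carrier S" "t \<in> carrier T" using assms by auto
  note cl = S_in_R[OF C(1)] S_in_R[OF C(2)] \<alpha>_closed[OF C(3)] R.plus_closed R.star_closed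
  have "rplus R a \<otimes>\<^bsub>R\<^esub> b = rplus R a \<otimes>\<^bsub>R\<^esub> (rplus R b \<otimes>\<^bsub>R\<^esub> \<alpha> t)"
    using V_decomp(1)[OF assms(2)] by simp
  also have "\<dots> = rplus R b \<otimes>\<^bsub>R\<^esub> rplus R a \<otimes>\<^bsub>R\<^esub> \<alpha> t"
    using cl R.plus_comm[of a b] by (simp add: R.m_assoc[symmetric])
  also have "\<dots> = rplus R b \<otimes>\<^bsub>R\<^esub> a"
    using V_decomp(1)[OF assms(1)] cl by (simp add: R.m_assoc)
  finally show "rplus S a \<otimes>\<^bsub>S\<^esub> b = rplus S b \<otimes>\<^bsub>S\<^esub> a"
    using C S_ops S.plus_closed by simp
  have "a \<otimes>\<^bsub>R\<^esub> rstar R b = \<alpha> t \<otimes>\<^bsub>R\<^esub> rstar R a \<otimes>\<^bsub>R\<^esub> rstar R b"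
    using V_decomp(2)[OF assms(1)] by simp
  also have "\<dots> = \<alpha> t \<otimes>\<^bsub>R\<^esub> rstar R b \<otimes>\<^bsub>R\<^esub> rstar R a"
    using cl R.star_comm[of a b] by (simp add: R.m_assoc)
  also have "\<dots> = b \<otimes>\<^bsub>R\<^esub> rstar R a"
    using V_decomp(2)[OF assms(2)] by simp
  finally show "a \<otimes>\<^bsub>S\<^esub> rstar S b = b \<otimes>\<^bsub>S\<^esub> rstar S a"
    using C S_ops S.star_closed by simp
qed

lemma sigma_V: "sigma V = {(x, y). x \<in> carrier V \<and> y \<in> carrier V \<and> snd x = snd y}"
proof -
  have *: "(\<exists>e \<in> projections V. e \<otimes>\<^bsub>V\<^esub> (a, t) = e \<otimes>\<^bsub>V\<^esub> (b, u)) \<longleftrightarrow> t = u"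
    if at: "(a, t) \<in> carrier V" and bu: "(b, u) \<in> carrier V" for a t b u
  proof
    assume "\<exists>e \<in> projections V. e \<otimes>\<^bsub>V\<^esub> (a, t) = e \<otimes>\<^bsub>V\<^esub> (b, u)"
    \<comment> \<open>Projections of \<open>V\<close> have second coordinate 1, so multiplying by
      one leaves the second coordinate unchanged.\<close>
    then show "t = u" using that by (auto simp: projections_V)
  next
    assume "t = u"
    have C: "a \<in> carrier S" "b \<in> carrier S" using that by auto
    \<comment> \<open>The witness cuts both elements down to their common part: compatibility makes
      both products equal to a^+ b.\<close>
    let ?e = "rplus S a \<otimes>\<^bsub>S\<^esub> rplus S b"
    have "?e \<otimes>\<^bsub>S\<^esub> a = rplus S a \<otimes>\<^bsub>S\<^esub> (rplus S a \<otimes>\<^bsub>S\<^esub> b)"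
      using V_compatible(1)[of a t b] that \<open>t = u\<close> C by (simp add: S.m_assoc S.plus_closed)
    also have "\<dots> = rplus S a \<otimes>\<^bsub>S\<^esub> b"
      using C S.proj_idem[OF S.proj_plus[OF C(1)]] by (simp add: S.m_assoc[symmetric] S.plus_closed)
    also have "\<dots> = ?e \<otimes>\<^bsub>S\<^esub> b"
      using C by (simp add: S.m_assoc S.plus_closed S.plus_left)
    finally have "(?e, \<one>\<^bsub>T\<^esub>) \<otimes>\<^bsub>V\<^esub> (a, t) = (?e, \<one>\<^bsub>T\<^esub>) \<otimes>\<^bsub>V\<^esub> (b, u)"
      using \<open>t = u\<close> by simp
    moreover have "(?e, \<one>\<^bsub>T\<^esub>) \<in> projections V"
      using S.proj_mult[OF S.proj_plus S.proj_plus] C by (auto simp: projections_V)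
    ultimately show "\<exists>e \<in> projections V. e \<otimes>\<^bsub>V\<^esub> (a, t) = e \<otimes>\<^bsub>V\<^esub> (b, u)" by blast
  qed
  have "(x, y) \<in> sigma V \<longleftrightarrow> x \<in> carrier V \<and> y \<in> carrier V \<and> snd x = snd y" for x y
    using *[of "fst x" "snd x" "fst y" "snd y"] unfolding sigma_def prod.collapse by blast
  then show ?thesis by auto
qed

lemma proper_V: "proper V"
proof -
  have "x = y" if V: "x \<in> carrier V" "y \<in> carrier V" and "snd x = snd y"
    and pq: "rplus V x = rplus V y \<or> rstar V x = rstar V y" for x y
  proof -
    obtain a b t where xy: "x = (a, t)" "y = (b, t)" using \<open>snd x = snd y\<close> by (cases x; cases y) simp
    have "a \<in> carrier S" "b \<in> carrier S" using V xy by auto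
    then have "rplus R a = rplus R b \<or> rstar R a = rstar R b" using pq xy S_ops by simp
    then show ?thesis using V_decomp[of a t] V_decomp[of b t] V xy by metis
  qed
  then show ?thesis
    unfolding proper_def R_rel_def L_rel_def sigma_V Id_on_def by blast
qed

lemma snd_hom: "snd \<in> restriction_hom V (trivial_restriction T)"
  by (simp add: restriction_hom_def hom_def Pi_iff split_paired_all)

lemma fst_hom: "fst \<in> restriction_hom V S"
  by (simp add: restriction_hom_def hom_def Pi_iff split_paired_all)

lemma snd_image: "snd ` carrier V = carrier T"
proof
  show "snd ` carrier V \<subseteq> carrier T" by auto
  show "carrier T \<subseteq> snd ` carrier V" using V_onto_T by (metis image_eqI snd_conv subsetI)
qed

lemma sigma_quotient_V: "restriction_isomorphic (sigma_quotient V) (trivial_restriction T)"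
  by (rule V.sigma_quotient_isomorphic[OF T snd_hom snd_image sigma_V])

lemma P_separating_fst: "P_separating V fst"
  by (auto simp: P_separating_def projections_V inj_on_def)

lemma proj_image: "e \<in> projections S \<Longrightarrow> e \<in> fst ` carrier V"
  using V_proj by (metis fst_conv imageI)

lemma full_image: "full_subsemigroup (S\<lparr>carrier := fst ` carrier V\<rparr>) S"
  unfolding full_subsemigroup_def
proof
  show "restriction_subsemigroup (S\<lparr>carrier := fst ` carrier V\<rparr>) S"
  proof (rule S.restriction_subalgebra)
    show "fst ` carrier V \<subseteq> carrier S" by auto
    show "fst ` carrier V \<noteq> {}" using V.nonempty by simp
    show "x \<otimes>\<^bsub>S\<^esub> y \<in> fst ` carrier V" if xy: "x \<in> fst ` carrier V" "y \<in> fst ` carrier V" for x y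
    proof -
      obtain p q where pq: "p \<in> carrier V" "q \<in> carrier V" "x = fst p" "y = fst q"
        using xy by blast
      then have "x \<otimes>\<^bsub>S\<^esub> y = fst (p \<otimes>\<^bsub>V\<^esub> q)" by (cases p; cases q) simp
      then show ?thesis using V.m_closed pq by simp
    qed
    fix x assume "x \<in> fst ` carrier V"
    then have "x \<in> carrier S" by auto
    then show "rplus S x \<in> fst ` carrier V" "rstar S x \<in> fst ` carrier V"
      using proj_image S.proj_plus S.proj_star by auto
  qed
  show "projections S \<subseteq> carrier (S\<lparr>carrier := fst ` carrier V\<rparr>)"
    using proj_image by auto
qed

lemma cover_V:
  assumes "\<And>s. s \<in> carrier S \<Longrightarrow> \<exists>t \<in> carrier T. nat_le R s (\<alpha> t)"
  shows "fst ` carrier V = carrier S" "cover V S"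
proof -
  have "s \<in> fst ` carrier V" if s: "s \<in> carrier S" for s
  proof -
    obtain t where "(s, t) \<in> carrier V" using assms[OF s] s by auto
    then show ?thesis by (metis fst_conv imageI)
  qed
  then show *: "fst ` carrier V = carrier S" by auto
  show "cover V S"
    using V.restriction_semigroup_axioms proper_V fst_hom P_separating_fst *
    unfolding cover_def by blast
qed

section \<open>The fibres of the second projection as a copy of T among the permissible
  subsets\<close>

definition fibre :: "'t \<Rightarrow> ('a \<times> 't) set" where
  "fibre t = {x \<in> carrier V. snd x = t}"

lemma fibre_iff: "(a, u) \<in> fibre t \<longleftrightarrow> u = t \<and> (a, t) \<in> carrier V"
  by (auto simp: fibre_def)

text \<open>Nonemptiness rests on local absorption; downward closure holds because projections of
  \<open>V\<close> have second coordinate 1.\<close>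

lemma permissible_fibre:
  assumes "t \<in> carrier T"
  shows "permissible V (fibre t)"
proof (rule V.permissibleI)
  show "fibre t \<subseteq> carrier V" by (auto simp: fibre_def)
  show "fibre t \<noteq> {}" using V_onto_T[OF assms] fibre_iff by blast
  show "e \<otimes>\<^bsub>V\<^esub> x \<in> fibre t" if "x \<in> fibre t" "e \<in> projections V" for x e
  proof -
    have "e \<otimes>\<^bsub>V\<^esub> x \<in> carrier V" using that V.m_closed V.projD(1) by (auto simp: fibre_def)
    then show ?thesis using that by (cases x) (auto simp: fibre_def projections_V)
  qed
  show "rplus V x \<otimes>\<^bsub>V\<^esub> y = rplus V y \<otimes>\<^bsub>V\<^esub> x" "x \<otimes>\<^bsub>V\<^esub> rstar V y = y \<otimes>\<^bsub>V\<^esub> rstar V x"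
    if "x \<in> fibre t" "y \<in> fibre t" for x y
    using that V_compatible by (cases x; cases y; auto simp: fibre_iff)+
qed

text \<open>An element \<open>c \<le> \<alpha> t \<alpha> u\<close> factors as \<open>(c\<^sup>+ \<alpha> t) ((c\<^sup>+ \<alpha> t)\<^sup>* \<alpha> u)\<close>, and local
  absorption puts both factors into \<open>S\<close>.\<close>

lemma fibre_mult:
  assumes t: "t \<in> carrier T" and u: "u \<in> carrier T"
  shows "fibre (t \<otimes>\<^bsub>T\<^esub> u) = fibre t <#>\<^bsub>V\<^esub> fibre u"
proof
  show "fibre t <#>\<^bsub>V\<^esub> fibre u \<subseteq> fibre (t \<otimes>\<^bsub>T\<^esub> u)"
    using V_mult by (auto simp: set_mult_def fibre_iff simp del: V_simps(1))
  show "fibre (t \<otimes>\<^bsub>T\<^esub> u) \<subseteq> fibre t <#>\<^bsub>V\<^esub> fibre u"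
  proof
    fix x assume "x \<in> fibre (t \<otimes>\<^bsub>T\<^esub> u)"
    then obtain c where x: "x = (c, t \<otimes>\<^bsub>T\<^esub> u)" and cV: "(c, t \<otimes>\<^bsub>T\<^esub> u) \<in> carrier V"
      by (cases x) (auto simp: fibre_iff)
    let ?r = "\<alpha> t" and ?s = "\<alpha> u" and ?e = "rplus R c"
    have rs: "?r \<in> carrier R" "?s \<in> carrier R" using t u \<alpha>_closed by auto
    have cS: "c \<in> carrier S" and cR: "c \<in> carrier R"
      and le: "nat_le R c (?r \<otimes>\<^bsub>R\<^esub> ?s)" using cV S_in_R t u \<alpha>_mult by auto
    have eS: "?e \<in> projections S" using S.proj_plus[OF cS] S_ops(2)[OF cS] by simp
    have eR: "?e \<in> projections R" and eC: "?e \<in> carrier R"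
      using R.proj_plus[OF cR] R.plus_closed[OF cR] by auto
    \<comment> \<open>With r = \<alpha>(t) and s = \<alpha>(u), the chain c^+ \<le> (r s)^+ \<le>
      r^+ makes \<open>V_restrict\<close> applicable to c^+ and t.\<close>
    have "?e = ?e \<otimes>\<^bsub>R\<^esub> rplus R (?r \<otimes>\<^bsub>R\<^esub> ?s)"
      using R.nat_le_plus(3)[OF _ le] rs R.m_closed by simp
    also have "\<dots> = ?e \<otimes>\<^bsub>R\<^esub> rplus R (?r \<otimes>\<^bsub>R\<^esub> ?s) \<otimes>\<^bsub>R\<^esub> rplus R ?r"
      using R.plus_mult_left[OF rs] rs eC by (simp add: R.m_assoc R.m_closed R.plus_closed)
    also have "\<dots> = ?e \<otimes>\<^bsub>R\<^esub> rplus R ?r"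
      using R.nat_le_plus(3)[OF _ le] rs R.m_closed by simp
    finally have "nat_le R ?e (rplus R ?r)" using eR by (rule R.nat_leI[rotated])
    then have aV: "(?e \<otimes>\<^bsub>R\<^esub> ?r, t) \<in> carrier V" using eS t V_restrict by blast
    define a where "a = ?e \<otimes>\<^bsub>R\<^esub> ?r"
    have aS: "a \<in> carrier S" and aR: "a \<in> carrier R" using aV S_in_R a_def by auto
    have c: "c = a \<otimes>\<^bsub>R\<^esub> ?s"
      using R.nat_le_plus(2)[OF _ le] rs eC by (simp add: a_def R.m_assoc R.m_closed)
    \<comment> \<open>The aim is a^* \<le> s^+ for the second factor. Since a s = c, the ample law
      gives a s^+ = c^+ a = a, and taking stars yields a^* = a^* s^+.\<close>
    have "a \<otimes>\<^bsub>R\<^esub> rplus R ?s = ?e \<otimes>\<^bsub>R\<^esub> a"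
      using R.plus_ample[OF aR rs(2)] c by simp
    also have "\<dots> = a"
      using R.proj_idem[OF eR] eC rs by (simp add: a_def R.m_assoc[symmetric])
    finally have "rstar R a = rstar R (a \<otimes>\<^bsub>R\<^esub> rplus R ?s)" by simp
    also have "\<dots> = rstar R a \<otimes>\<^bsub>R\<^esub> rplus R ?s"
      using R.star_mult[of "rplus R ?s" a] aR rs by (simp add: R.plus_closed R.star_plus)
    finally have "nat_le R (rstar R a) (rplus R ?s)"
      using R.proj_star[OF aR] by (rule R.nat_leI[rotated])
    moreover have "rstar R a \<in> projections S"
      using S.proj_star[OF aS] S_ops(3)[OF aS] by simp
    ultimately have bV: "(rstar R a \<otimes>\<^bsub>R\<^esub> ?s, u) \<in> carrier V" using u V_restrict by blast
    have "a \<otimes>\<^bsub>R\<^esub> (rstar R a \<otimes>\<^bsub>R\<^esub> ?s) = c"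
      using aR rs c by (simp add: R.m_assoc[symmetric] R.star_closed R.star_right)
    then have "x = (a, t) \<otimes>\<^bsub>V\<^esub> (rstar R a \<otimes>\<^bsub>R\<^esub> ?s, u)"
      using x S_ops(1) aS bV by simp
    moreover have "(a, t) \<in> fibre t" "(rstar R a \<otimes>\<^bsub>R\<^esub> ?s, u) \<in> fibre u"
      using aV bV by (simp_all add: fibre_iff a_def del: V_simps)
    ultimately show "x \<in> fibre t <#>\<^bsub>V\<^esub> fibre u"
      unfolding set_mult_def by blast
  qed
qed

text \<open>An element below \<alpha>(1) = 1 satisfies a = a^+ 1, so it is a projection.\<close>

lemma fibre_one: "fibre \<one>\<^bsub>T\<^esub> = projections V"
proof
  show "projections V \<subseteq> fibre \<one>\<^bsub>T\<^esub>"
    using V_proj by (auto simp: projections_V fibre_iff simp del: V_simps)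
  show "fibre \<one>\<^bsub>T\<^esub> \<subseteq> projections V"
  proof
    fix x assume "x \<in> fibre \<one>\<^bsub>T\<^esub>"
    then obtain a where x: "x = (a, \<one>\<^bsub>T\<^esub>)" and aV: "(a, \<one>\<^bsub>T\<^esub>) \<in> carrier V"
      by (cases x) (auto simp: fibre_iff)
    then have a: "a \<in> carrier S" by simp
    then have "a = rplus R a"
      using V_decomp(1)[OF aV] S_in_R[OF a] \<alpha>(2) R.plus_closed by simp
    then show "x \<in> projections V"
      using x S.proj_plus[OF a] S_ops(2)[OF a] by (simp add: projections_V)
  qed
qed

lemma almost_T_proper_V: "almost_T_proper V T"
  unfolding almost_T_proper_def
proof (rule T_properI[where \<beta> = fibre])
  show "restriction_monoid (C_monoid V)" by (rule V.C_monoid_restriction)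
  show "monoid T" by (rule T)
  show "fibre \<in> hom T (C_monoid V)"
    using permissible_fibre fibre_mult by (simp add: hom_def)
  show "fibre \<one>\<^bsub>T\<^esub> = \<one>\<^bsub>C_monoid V\<^esub>" by (simp add: fibre_one)
  show "\<exists>E \<in> projections (C_monoid V). \<exists>t \<in> carrier T. A = E \<otimes>\<^bsub>C_monoid V\<^esub> fibre t"
    if "A \<in> carrier (C_monoid V)" for A
  proof -
    have A: "permissible V A" using that by simp
    note AV = V.permissibleD(1)[OF A]
    obtain a t where at: "(a, t) \<in> A" using V.permissibleD(2)[OF A] by auto
    have tT: "t \<in> carrier T" using at AV by auto
    \<comment> \<open>The two sides of a^+ b = b^+ a, taken in \<open>V\<close>, have second
      coordinates u and t.\<close>
    have snd: "u = t" if bu: "(b, u) \<in> A" for b u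
    proof -
      have "u \<in> carrier T" using bu AV by auto
      then show ?thesis using V.permissibleD(4)[OF A at bu] tT by simp
    qed
    have "A \<subseteq> (rplus V ` A) <#>\<^bsub>V\<^esub> fibre t"
    proof
      fix x assume x: "x \<in> A"
      then have "x \<in> fibre t" using snd AV by (cases x) (auto simp: fibre_def)
      moreover have "x = rplus V x \<otimes>\<^bsub>V\<^esub> x" using V.plus_left[OF subsetD[OF AV x]] by simp
      ultimately show "x \<in> (rplus V ` A) <#>\<^bsub>V\<^esub> fibre t" using x by (auto simp: set_mult_def)
    qed
    \<comment> \<open>The element y need not lie in \<open>A\<close>, but it shares a fibre with x,
      so x^+ y = y^+ x, a restriction of an element of \<open>A\<close>.\<close>
    moreover have "rplus V x \<otimes>\<^bsub>V\<^esub> y \<in> A" if x: "x \<in> A" and y: "y \<in> fibre t" for x y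
    proof -
      have "x \<in> fibre t" using x snd AV by (cases x) (auto simp: fibre_def)
      then have "rplus V x \<otimes>\<^bsub>V\<^esub> y = rplus V y \<otimes>\<^bsub>V\<^esub> x"
        using V.permissibleD(4)[OF permissible_fibre[OF tT]] y by blast
      moreover have "y \<in> carrier V" using y by (simp add: fibre_def)
      ultimately show ?thesis using V.permissibleD(3)[OF A x V.proj_plus] by simp
    qed
    ultimately have "A = rplus V ` A \<otimes>\<^bsub>C_monoid V\<^esub> fibre t"
      unfolding C_monoid_simps set_mult_def by blast
    moreover have "rplus V ` A \<in> projections (C_monoid V)"
      unfolding projections_def using A by (metis C_monoid_simps(1,4) imageI)
    ultimately show ?thesis using tT by blast
  qed
  show "t = u" if tu: "t \<in> carrier T" "u \<in> carrier T" and s: "(fibre t, fibre u) \<in> sigma (C_monoid V)" for t u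
  proof -
    obtain A where A: "permissible V A"
      and eq: "(rplus V ` A) <#>\<^bsub>V\<^esub> fibre t = (rplus V ` A) <#>\<^bsub>V\<^esub> fibre u"
      using s by (auto simp: sigma_def projections_def)
    \<comment> \<open>One element of the common product suffices: as a member of the left side it
      has second coordinate t, as a member of the right side u, since the factors from A^+
      contribute 1.\<close>
    obtain b v where b: "(b, v) \<in> A" using V.permissibleD(2)[OF A] by auto
    obtain a where a: "(a, t) \<in> fibre t" using V_onto_T[OF tu(1)] fibre_iff by blast
    have "rplus V (b, v) \<otimes>\<^bsub>V\<^esub> (a, t) \<in> (rplus V ` A) <#>\<^bsub>V\<^esub> fibre u"
      unfolding eq[symmetric] using a b unfolding set_mult_def by blast
    then obtain y z where y: "y \<in> A" and z: "z \<in> fibre u"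
      and e: "rplus V (b, v) \<otimes>\<^bsub>V\<^esub> (a, t) = rplus V y \<otimes>\<^bsub>V\<^esub> z"
      unfolding set_mult_def by blast
    then show ?thesis using tu by (cases y; cases z) (auto simp: fibre_iff)
  qed
qed

text \<open>When \<alpha> takes its values in \<open>S\<close>, its graph lies in \<open>V\<close>
  and is itself the copy of \<open>T\<close>; each fibre has (\<alpha>(t), t) as its top, and the
  other elements are restrictions of it.\<close>

lemma T_proper_V:
  assumes RS: "carrier R = carrier S" and S1: "monoid S"
  shows "T_proper V T"
proof -
  interpret SM: monoid S by (rule S1)
  \<comment> \<open>The \<open>one\<close> fields of the two records are independent data; they
    agree by uniqueness of identities, the products coinciding on the common carrier.\<close>
  have one: "\<one>\<^bsub>S\<^esub> = \<one>\<^bsub>R\<^esub>"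
    by (metis RM.l_one RM.one_closed RS SM.one_closed SM.r_one S_ops(1))
  have gen: "(\<alpha> t, t) \<in> carrier V" if "t \<in> carrier T" for t
  proof -
    have "\<alpha> t = rplus R (\<alpha> t) \<otimes>\<^bsub>R\<^esub> \<alpha> t" using that \<alpha>_closed R.plus_left by simp
    then show ?thesis
      using that \<alpha>_closed RS R.proj_plus R.nat_leI by (metis V_simps(1))
  qed
  have oneV: "\<one>\<^bsub>V\<^esub> \<in> carrier V" using gen[OF T.one_closed] \<alpha>(2) one by simp
  show ?thesis
  proof (rule T_properI[where \<beta> = "\<lambda>t. (\<alpha> t, t)"])
    have "monoid V"
      by unfold_locales (use oneV V.m_closed V.m_assoc in \<open>auto simp del: V_simps(1)\<close>, auto)
    then show "restriction_monoid V"
      using V.restriction_semigroup_axioms by (simp add: restriction_monoid_def)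
    show "monoid T" by (rule T)
    show "(\<lambda>t. (\<alpha> t, t)) \<in> hom T V"
      using gen \<alpha>_mult S_ops(1) \<alpha>_closed RS by (auto simp: hom_def simp del: V_simps(1))
    show "(\<alpha> \<one>\<^bsub>T\<^esub>, \<one>\<^bsub>T\<^esub>) = \<one>\<^bsub>V\<^esub>" using one \<alpha>(2) by simp
    show "\<exists>e \<in> projections V. \<exists>t \<in> carrier T. x = e \<otimes>\<^bsub>V\<^esub> (\<alpha> t, t)" if xV: "x \<in> carrier V" for x
    proof -
      obtain a t where x: "x = (a, t)" by (cases x)
      have a: "a \<in> carrier S" and t: "t \<in> carrier T" using xV x by auto
      have "a = rplus S a \<otimes>\<^bsub>S\<^esub> \<alpha> t"
        using V_decomp(1)[of a t] xV x a t S_ops \<alpha>_closed RS R.plus_closed by simp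
      then have "x = (rplus S a, \<one>\<^bsub>T\<^esub>) \<otimes>\<^bsub>V\<^esub> (\<alpha> t, t)" using x t by simp
      moreover have "(rplus S a, \<one>\<^bsub>T\<^esub>) \<in> projections V"
        using S.proj_plus[OF a] by (simp add: projections_V)
      ultimately show ?thesis using t by blast
    qed
    show "t = u" if "((\<alpha> t, t), (\<alpha> u, u)) \<in> sigma V" for t u
      using that by (simp add: sigma_V)
  qed
qed

end

theorem theorem4p1:
  fixes S :: "('a, 'b) restriction_scheme"
    and R :: "('a, 'c) restriction_scheme"
    and T :: "('t, 'd) monoid_scheme"
    and \<alpha> :: "'t \<Rightarrow> 'a"
  assumes "restriction_semigroup S"
    and "restriction_monoid R"
    and "restriction_subsemigroup S R"
    and "locally_absorbs S R"
    and "monoid T"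
    and "\<alpha> \<in> hom T R" and "\<alpha> \<one>\<^bsub>T\<^esub> = \<one>\<^bsub>R\<^esub>"
  shows
    "restriction_subsemigroup (S_TR S T R \<alpha>) (restriction_prod S (trivial_restriction T))
     \<and> almost_T_proper (S_TR S T R \<alpha>) T
     \<and> restriction_isomorphic (sigma_quotient (S_TR S T R \<alpha>)) (trivial_restriction T)
     \<and> fst \<in> restriction_hom (S_TR S T R \<alpha>) S
     \<and> P_separating (S_TR S T R \<alpha>) fst
     \<and> full_subsemigroup (S\<lparr>carrier := fst ` carrier (S_TR S T R \<alpha>)\<rparr>) S
     \<and> ((\<forall>s \<in> carrier S. \<exists>t \<in> carrier T. nat_le R s (\<alpha> t)) \<longrightarrow>
          subdirect_product (S_TR S T R \<alpha>) S (trivial_restriction T)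
          \<and> cover_over (S_TR S T R \<alpha>) S T)
     \<and> (is_S1 R S \<and> P_generates (\<alpha> ` carrier T) R \<longrightarrow> cover (S_TR S T R \<alpha>) S)
     \<and> (is_S1 R S \<and> monoid S \<longrightarrow> T_proper (S_TR S T R \<alpha>) T)"
proof -
  interpret restriction_cover S R T \<alpha> by (rule restriction_cover.intro) fact+
  have "cover V S \<and> subdirect_product V S (trivial_restriction T)"
    if "\<forall>s \<in> carrier S. \<exists>t \<in> carrier T. nat_le R s (\<alpha> t)"
    using cover_V that V_subsemigroup snd_image by (simp add: subdirect_product_def)
  \<comment> \<open>An equation s = e \<alpha>(t) with e a projection of \<open>R\<close> is
    literally s \<le> \<alpha>(t), so P-generation puts every element of \<open>S\<close> below some
    \<alpha>(t).\<close>
  moreover have "cover V S" if gen: "P_generates (\<alpha> ` carrier T) R"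
  proof (rule cover_V(2))
    fix s assume "s \<in> carrier S"
    then have "s \<in> projections R <#>\<^bsub>R\<^esub> (\<alpha> ` carrier T)"
      using gen S_in_R by (simp add: P_generates_def)
    then show "\<exists>t \<in> carrier T. nat_le R s (\<alpha> t)"
      by (auto simp: set_mult_def nat_le_def)
  qed
  moreover have "T_proper V T" if "is_S1 R S" "monoid S"
  proof (rule T_proper_V)
    \<comment> \<open>Selects the branch of \<open>is_S1\<close> in which nothing is
      adjoined.\<close>
    have "has_identity S"
      unfolding has_identity_def
      using monoid.one_closed monoid.l_one monoid.r_one that(2) by metis
    then show "carrier R = carrier S" using that(1) by (simp add: is_S1_def)
  qed (rule that(2))
  ultimately show ?thesis
    using V_subsemigroup almost_T_proper_V sigma_quotient_V fst_hom P_separating_fst full_image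
    by (simp add: cover_over_def)
qed

end
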